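(* Let $q_1,\dots,q_n$ be densities with respect to a measure $\lambda$ on $\mathbb{R}^d$, let $\delta$ be a dissimilarity on densities, and set $\delta_{ij}=\delta(q_i,q_j)$. Let $n$ and the embedding dimension $d_e$ be fixed. For each $j$, let $\mathcal{S}_j$ be a sample of size $m_j$ from $q_j$, and suppose that based on the samples we produce dissimilarities $(\hat\delta_{ij})$ consistent for $(\delta_{ij})$. Let $(\hat\nu_k,\hat u_k)$, $k=1,\dots,d_e$, be the top $d_e$ eigenpairs of $\hat B$ and $\hat p_i=\big(\sqrt{\hat\nu_1^+}\,\hat u_{i,1},\dots,\sqrt{\hat\nu_{d_e}^+}\,\hat u_{i,d_e}\big)$. Then classical scaling (CS) applied to $(\hat\delta_{ij})$ is consistent in the sense that it asymptotically ($m_j\to\infty$ for all $j$, with $n$ fixed) recovers an embedding that results from applying CS to $(\delta_{ij})$, with the following rate of convergence: for some $C>0$ depending only on $(\delta_{ij})$ and $d_e$, $$\min_{\{p_1,\dots,p_n\}}\sum_{i=1}^n\|p_i-\hat p_i\|_2^2\le C\,n^2\begin{cases}\|A-\hat A\|_2^2,&\text{if }\nu_{d_e}>0;\\ \|A-\hat A\|_2,&\text{if }\nu_{d_e}=0,\end{cases}$$ where the minimum is over the set of configurations $p_1,\dots,p_n\in\mathbb{R}^{d_e}$ minimizing the strain $\sum_{i,j}(\langle p_i,p_j\rangle-b_{ij})^2$.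
   Context: A dissimilarity is a function $\delta\ge0$ with $\delta(q,q_0)=0\Leftrightarrow q=q_0$ and $\delta(q,q_0)=\delta(q_0,q)$; $(\hat\delta_{ij})$ is likewise nonnegative and symmetric. Consistent means $\hat\delta_{ij}\to\delta_{ij}$ in probability for all $i,j$ as $m_j\to\infty$ for all $j$. Notation: $A=(a_{ij})$ with $a_{ij}=-\frac12\delta_{ij}^2$; $B=(b_{ij})$ is the double-centered matrix $b_{ij}=a_{ij}-\bar a_{i\cdot}-\bar a_{\cdot j}+\bar a_{\cdot\cdot}$ (row mean, column mean, overall mean); $\nu_1\ge\nu_2\ge\dots$ are the eigenvalues of $B$. $\hat A$ and $\hat B$ are defined in the same way from $(\hat\delta_{ij})$. Eigenvectors are orthonormal, eigenvalues ordered decreasingly, $\hat u_k=(\hat u_{1,k},\dots,\hat u_{n,k})$, and $a^+=\max(a,0)$. For matrices $\|\cdot\|_2$ is the Frobenius norm, for vectors the Euclidean norm. CS applied to $(\delta_{ij})$ returns $p_i=(\sqrt{\nu_1^+}u_{i,1},\dots,\sqrt{\nu_{d_e}^+}u_{i,d_e})$, where $u_1,\dots,u_{d_e}$ are orthonormal eigenvectors of $B$ for $\nu_1\ge\dots\ge\nu_{d_e}$. *)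

theory Defs
  imports "HOL-Probability.Probability"
begin

definition is_density :: "'x measure \<Rightarrow> ('x \<Rightarrow> real) \<Rightarrow> bool" where
  "is_density L f \<longleftrightarrow>
     f \<in> borel_measurable L \<and> (\<forall>x. 0 \<le> f x) \<and> (\<integral>\<^sup>+x. ennreal (f x) \<partial>L) = 1"

text \<open>Densities are identified when they agree \<open>L\<close>-almost everywhere; otherwise not even the
  Hellinger or the \<open>L1\<close> distance would be a dissimilarity.\<close>

definition dissimilarity :: "'x measure \<Rightarrow> (('x \<Rightarrow> real) \<Rightarrow> ('x \<Rightarrow> real) \<Rightarrow> real) \<Rightarrow> bool" where
  "dissimilarity L \<delta> \<longleftrightarrow> (\<forall>f g. is_density L f \<longrightarrow> is_density L g \<longrightarrow>
     0 \<le> \<delta> f g \<and> (\<delta> f g = 0 \<longleftrightarrow> (AE x in L. f x = g x)) \<and> \<delta> f g = \<delta> g f)"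

definition nonneg_symmetric :: "real^'n^'n \<Rightarrow> bool" where
  "nonneg_symmetric D \<longleftrightarrow> (\<forall>i j. 0 \<le> D $ i $ j \<and> D $ i $ j = D $ j $ i)"

text \<open>The random variables \<open>X 0, \<dots>, X (k - 1)\<close> form an i.i.d. sample of size \<open>k\<close> from the
  distribution with density \<open>f\<close> with respect to \<open>L\<close>.\<close>

definition iid_sample ::
  "'w measure \<Rightarrow> 'x measure \<Rightarrow> ('x \<Rightarrow> real) \<Rightarrow> nat \<Rightarrow> (nat \<Rightarrow> 'w \<Rightarrow> 'x) \<Rightarrow> bool" where
  "iid_sample M L f k X \<longleftrightarrow>
     prob_space.indep_vars M (\<lambda>_. L) X {..<k} \<and>
     (\<forall>l<k. distributed M L (X l) (\<lambda>x. ennreal (f x)))"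

text \<open>The filter expressing \<open>m\<^sub>j \<rightarrow> \<infinity>\<close> for every \<open>j\<close>.\<close>

definition sizes_to_infinity :: "('n \<Rightarrow> nat) filter" where
  "sizes_to_infinity = (INF j. filtercomap (\<lambda>m. m j) at_top)"

text \<open>The outer measure agrees with the probability on events. It is used because eigenvectors
  may be chosen non-measurably, and \<open>measure M\<close> is 0 on non-measurable sets.\<close>

definition tendsto_in_prob ::
  "'w measure \<Rightarrow> ('i \<Rightarrow> 'w \<Rightarrow> real) \<Rightarrow> real \<Rightarrow> 'i filter \<Rightarrow> bool" where
  "tendsto_in_prob M X c F \<longleftrightarrow> (\<forall>\<epsilon>>0.
     ((\<lambda>m. outer_measure_of M {\<omega> \<in> space M. \<epsilon> < \<bar>X m \<omega> - c\<bar>}) \<longlongrightarrow> 0) F)"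

text \<open>On the type \<open>real^'n^'n\<close> the library's \<^const>\<open>norm\<close> is the Frobenius norm.\<close>

definition A_matrix :: "real^'n^'n \<Rightarrow> real^'n^'n" where
  "A_matrix D = (\<chi> i j. - (1/2) * (D $ i $ j)\<^sup>2)"

definition double_center :: "real^'n^'n \<Rightarrow> real^'n^'n" where
  "double_center A = (\<chi> i j. A $ i $ j
     - (\<Sum>l\<in>UNIV. A $ i $ l) / real CARD('n)
     - (\<Sum>k\<in>UNIV. A $ k $ j) / real CARD('n)
     + (\<Sum>k\<in>UNIV. \<Sum>l\<in>UNIV. A $ k $ l) / (real CARD('n))\<^sup>2)"

definition B_matrix :: "real^'n^'n \<Rightarrow> real^'n^'n" where
  "B_matrix D = double_center (A_matrix D)"

text \<open>Indices run over \<open>1, \<dots>, n\<close>. The eigenvalues are listed with multiplicity, in decreasing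
  order, together with an orthonormal basis of eigenvectors.\<close>

definition ordered_eigenpairs :: "real^'n^'n \<Rightarrow> (nat \<Rightarrow> real) \<Rightarrow> (nat \<Rightarrow> real^'n) \<Rightarrow> bool" where
  "ordered_eigenpairs B \<nu> u \<longleftrightarrow>
     (\<forall>k\<in>{1..CARD('n)}. B *v u k = \<nu> k *\<^sub>R u k) \<and>
     (\<forall>k\<in>{1..CARD('n)}. \<forall>l\<in>{1..CARD('n)}. u k \<bullet> u l = (if k = l then 1 else 0)) \<and>
     (\<forall>k\<in>{1..CARD('n)}. \<forall>l\<in>{1..CARD('n)}. k \<le> l \<longrightarrow> \<nu> l \<le> \<nu> k)"

text \<open>Points of \<open>d\<close>-dimensional Euclidean space, with \<open>d\<close> a natural number, are the
  functions on \<open>{1..d}\<close>; the Euclidean norm is \<^term>\<open>\<lambda>x. L2_set x {1..d}\<close>.\<close>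

definition configurations :: "nat \<Rightarrow> ('n \<Rightarrow> nat \<Rightarrow> real) set" where
  "configurations d = {p. \<forall>i. p i \<in> {1..d} \<rightarrow>\<^sub>E UNIV}"

definition config_error :: "nat \<Rightarrow> ('n::finite \<Rightarrow> nat \<Rightarrow> real) \<Rightarrow> ('n \<Rightarrow> nat \<Rightarrow> real) \<Rightarrow> real" where
  "config_error d p p' = (\<Sum>i\<in>UNIV. (L2_set (\<lambda>k. p i k - p' i k) {1..d})\<^sup>2)"

definition strain :: "nat \<Rightarrow> real^'n^'n \<Rightarrow> ('n::finite \<Rightarrow> nat \<Rightarrow> real) \<Rightarrow> real" where
  "strain d B p = (\<Sum>i\<in>UNIV. \<Sum>j\<in>UNIV. ((\<Sum>k=1..d. p i k * p j k) - B $ i $ j)\<^sup>2)"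

definition strain_minimizers :: "nat \<Rightarrow> real^'n^'n \<Rightarrow> ('n::finite \<Rightarrow> nat \<Rightarrow> real) set" where
  "strain_minimizers d B = {p. is_arg_min (strain d B) (\<lambda>p'. p' \<in> configurations d) p}"

text \<open>The set of all possible outputs of classical scaling: the output depends on the choice of
  the eigenvectors.\<close>

definition classical_scaling :: "nat \<Rightarrow> real^'n^'n \<Rightarrow> ('n::finite \<Rightarrow> nat \<Rightarrow> real) set" where
  "classical_scaling d D =
     {(\<lambda>i. \<lambda>k\<in>{1..d}. sqrt (max (\<nu> k) 0) * u k $ i) | \<nu> u. ordered_eigenpairs (B_matrix D) \<nu> u}"

end

theory Submission
  imports Defs
begin

text \<open>Write \<open>B\<close> and \<open>B'\<close> for the double-centered matrices of \<open>D\<close> and of a perturbation \<open>D'\<close>, and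
  \<open>e = |B - B'|\<close>. Double-centering is linear, so \<open>e\<close> is at most a constant times \<open>|A - A'|\<close>.
  An output of classical scaling is a configuration whose \<open>k\<close>-th coordinates form the vector
  \<open>sqrt \<nu>\<^sub>k\<^sup>+ u\<^sub>k\<close>. Both halves of the theorem follow from one estimate,
  \<open>classical_scaling_perturbation\<close>: near every output \<open>p'\<close> for \<open>D'\<close> there is an output
  \<open>p\<close> for \<open>D\<close>, with squared distance \<open>O(e)\<close> in general and \<open>O(e\<^sup>2)\<close> if \<open>\<nu>\<^sub>d > 0\<close>.

  The estimate compares the two factors of \<open>sqrt \<nu>\<^sub>k\<^sup>+ u\<^sub>k\<close> separately. Eigenvalues move by at most
  \<open>e\<close> (\<open>Weyl_inequality\<close>). The square root is Lipschitz away from 0, which gives a squared error of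
  order \<open>e\<^sup>2\<close> as long as \<open>\<nu>\<^sub>k > 0\<close>; at 0 it is only Hoelder continuous with exponent 1/2, and this is
  where the slower rate comes from. Eigenvectors do not depend continuously on the matrix when an
  eigenvalue is repeated, but \<open>p\<close> may be chosen after \<open>p'\<close>: given the eigenvectors \<open>u'\<^sub>k\<close> of \<open>B'\<close>,
  the projection of \<open>u'\<^sub>k\<close> to the eigenspace of \<open>B\<close> for \<open>\<nu>\<^sub>k\<close> moves it by \<open>O(e)\<close>, because the
  other eigenvalues of \<open>B\<close> stay away from \<open>\<nu>\<^sub>k\<close>. Gram-Schmidt turns the projections into an
  orthonormal eigenbasis of \<open>B\<close> at distance \<open>O(e)\<close> from \<open>u'\<close> (\<open>eigenvector_perturbation\<close>).

  To pass from outputs of classical scaling to minimizers of the strain, the output \<open>p\<close> is shown to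
  be a minimizer (\<open>classical_scaling_minimizes_strain\<close>, an Eckart-Young theorem for positive
  semidefinite approximants), so that a minimizer closest to \<open>p'\<close> is at least as close as \<open>p\<close>. It
  exists by compactness. Consistency follows from the estimate \<open>O(|A - A'|)\<close>, since \<open>A\<close> is a
  continuous function of the dissimilarities, of which there are finitely many.\<close>

section \<open>Orthonormal families\<close>

definition orthonormal_upto :: "nat \<Rightarrow> (nat \<Rightarrow> 'a::real_inner) \<Rightarrow> bool" where
  "orthonormal_upto m u \<longleftrightarrow> (\<forall>k\<in>{1..m}. \<forall>l\<in>{1..m}. u k \<bullet> u l = (if k = l then 1 else 0))"

lemma orthonormal_upto_inner:
  "orthonormal_upto m u \<Longrightarrow> k \<in> {1..m} \<Longrightarrow> l \<in> {1..m} \<Longrightarrow> u k \<bullet> u l = (if k = l then 1 else 0)"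
  unfolding orthonormal_upto_def by blast

lemma orthonormal_upto_norm:
  assumes "orthonormal_upto m u" "k \<in> {1..m}"
  shows "norm (u k) = 1"
  using orthonormal_upto_inner[OF assms(1) assms(2) assms(2)] by (simp add: norm_eq_1)

lemma orthonormal_upto_inj:
  assumes "orthonormal_upto m u"
  shows "inj_on u {1..m}"
proof (rule inj_onI)
  fix k l assume kl: "k \<in> {1..m}" "l \<in> {1..m}" "u k = u l"
  then have "u k \<bullet> u l = 1" using orthonormal_upto_inner[OF assms kl(1) kl(1)] by simp
  then show "k = l" using orthonormal_upto_inner[OF assms kl(1,2)] by (simp split: if_splits)
qed

lemma orthonormal_upto_independent:
  fixes u :: "nat \<Rightarrow> 'a::euclidean_space"
  assumes "orthonormal_upto m u" "I \<subseteq> {1..m}"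
  shows "independent (u ` I)"
proof (rule pairwise_orthogonal_independent)
  show "pairwise orthogonal (u ` I)"
    using assms unfolding pairwise_def orthogonal_def orthonormal_upto_def by (auto simp: subset_iff)
  show "0 \<notin> u ` I"
    using assms orthonormal_upto_norm[OF assms(1)] by (metis imageE in_mono norm_zero zero_neq_one)
qed

lemma orthonormal_upto_dim_span:
  fixes u :: "nat \<Rightarrow> 'a::euclidean_space"
  assumes "orthonormal_upto m u" "I \<subseteq> {1..m}"
  shows "dim (span (u ` I)) = card I"
proof -
  have "dim (span (u ` I)) = card (u ` I)"
    by (simp add: dim_eq_card_independent orthonormal_upto_independent[OF assms])
  then show ?thesis
    by (simp add: card_image inj_on_subset[OF orthonormal_upto_inj[OF assms(1)] assms(2)])
qed

lemma orthonormal_upto_basis: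
  fixes u :: "nat \<Rightarrow> 'a::euclidean_space"
  assumes "orthonormal_upto DIM('a) u"
  shows "span (u ` {1..DIM('a)}) = UNIV"
  using orthonormal_upto_dim_span[OF assms subset_refl]
  by (metis card_atLeastAtMost diff_Suc_1 dim_eq_full dim_span One_nat_def Suc_eq_plus1 span_span)

lemma orthonormal_expansion:
  fixes u :: "nat \<Rightarrow> 'a::euclidean_space"
  assumes "orthonormal_upto DIM('a) u"
  shows "x = (\<Sum>k=1..DIM('a). (x \<bullet> u k) *\<^sub>R u k)"
proof -
  define y where "y = x - (\<Sum>k=1..DIM('a). (x \<bullet> u k) *\<^sub>R u k)"
  have "y \<bullet> u l = 0" if "l \<in> {1..DIM('a)}" for l
  proof -
    have "(\<Sum>k=1..DIM('a). (x \<bullet> u k) * (u k \<bullet> u l)) = (\<Sum>k=1..DIM('a). if k = l then x \<bullet> u k else 0)"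
      using orthonormal_upto_inner[OF assms _ that] by (intro sum.cong) auto
    also have "\<dots> = x \<bullet> u l" using that by (simp add: sum.delta)
    finally show ?thesis by (simp add: y_def inner_diff_left inner_sum_left)
  qed
  then have "orthogonal y z" if "z \<in> span (u ` {1..DIM('a)})" for z
    by (intro orthogonal_to_span[OF that]) (auto simp: orthogonal_def)
  then have "orthogonal y y" unfolding orthonormal_upto_basis[OF assms] by blast
  then show ?thesis by (simp add: y_def orthogonal_def)
qed

lemma orthonormal_Parseval:
  fixes u :: "nat \<Rightarrow> 'a::euclidean_space"
  assumes "orthonormal_upto DIM('a) u"
  shows "x \<bullet> y = (\<Sum>k=1..DIM('a). (x \<bullet> u k) * (y \<bullet> u k))"
proof -
  have "x \<bullet> y = x \<bullet> (\<Sum>k=1..DIM('a). (y \<bullet> u k) *\<^sub>R u k)"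
    using orthonormal_expansion[OF assms, of y] by simp
  then show ?thesis by (simp add: inner_sum_right mult.commute)
qed

lemma orthonormal_Parseval_norm:
  fixes u :: "nat \<Rightarrow> 'a::euclidean_space"
  assumes "orthonormal_upto DIM('a) u"
  shows "(norm x)\<^sup>2 = (\<Sum>k=1..DIM('a). (x \<bullet> u k)\<^sup>2)"
  using orthonormal_Parseval[OF assms, of x x] by (simp only: power2_norm_eq_inner) (simp add: power2_eq_square)

section \<open>The spectral theorem\<close>

lemma symmetric_matrix_inner:
  fixes B :: "real^'n^'n"
  assumes "transpose B = B"
  shows "(B *v x) \<bullet> y = x \<bullet> (B *v y)"
  by (metis assms dot_lmul_matrix vector_transpose_matrix)

lemma norm_matrix_vector_le:
  fixes E :: "real^'n^'m"
  shows "norm (E *v x) \<le> norm E * norm x"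
proof -
  have "norm (E *v x) \<le> L2_set (\<lambda>i. norm (E $ i) * norm x) UNIV"
    unfolding norm_vec_def[of "E *v x"]
    by (rule L2_set_mono) (auto simp: matrix_vector_mul_component Cauchy_Schwarz_ineq2)
  also have "\<dots> = norm E * norm x"
    by (simp add: norm_vec_def[of E] L2_set_left_distrib)
  finally show ?thesis .
qed

text \<open>The first-order condition of a maximum: it is applied to a variation with parameter \<open>t\<close>, whose
  linear part has to vanish.\<close>
lemma quadratic_le_linear_zero:
  fixes a c :: real
  assumes "\<And>t. 2 * t * a \<le> t\<^sup>2 * c"
  shows "a = 0"
proof (rule ccontr)
  assume "a \<noteq> 0"
  define s where "s = \<bar>c\<bar> + 1"
  have s: "s > 0" "c < s" by (auto simp: s_def)
  have "2 * (a / s) * a \<le> (a / s)\<^sup>2 * c" by (rule assms)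
  then have "2 * a\<^sup>2 * s \<le> a\<^sup>2 * c"
    using s by (simp add: field_simps power2_eq_square)
  then have "2 * s \<le> c" using \<open>a \<noteq> 0\<close> by (simp add: algebra_simps)
  then show False using s by linarith
qed

text \<open>The residual \<open>r = B v - \<mu> v\<close> is orthogonal to \<open>v\<close> and lies in the invariant subspace \<open>S\<close>.
  Moving from \<open>v\<close> in the direction \<open>r\<close> changes the quadratic form, relative to the bound given by
  \<open>\<mu>\<close>, by \<open>2 t |r|\<^sup>2\<close> up to terms of order \<open>t\<^sup>2\<close>; maximality therefore forces \<open>r = 0\<close>.\<close>
lemma constrained_maximizer_is_eigenvector:
  fixes B :: "real^'n^'n"
  assumes sym: "transpose B = B" and S: "subspace S" and inv: "\<And>x. x \<in> S \<Longrightarrow> B *v x \<in> S"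
    and v: "v \<in> S" "norm v = 1" and mu: "\<mu> = v \<bullet> (B *v v)"
    and max: "\<And>x. x \<in> S \<Longrightarrow> x \<bullet> (B *v x) \<le> \<mu> * (norm x)\<^sup>2"
  shows "B *v v = \<mu> *\<^sub>R v"
proof -
  define r where "r = B *v v - \<mu> *\<^sub>R v"
  have vv: "v \<bullet> v = 1" using v by (simp add: norm_eq_1)
  have rS: "r \<in> S" unfolding r_def using S inv v by (intro subspace_diff subspace_scale) auto
  have rv: "r \<bullet> v = 0" by (simp add: r_def inner_diff_left mu vv inner_commute[of "B *v v" v])
  have rB: "r \<bullet> (B *v v) = r \<bullet> r"
    using rv by (simp add: r_def inner_diff_left inner_diff_right)
  have "2 * t * (r \<bullet> r) \<le> t\<^sup>2 * (\<mu> * (r \<bullet> r) - r \<bullet> (B *v r))" for t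
  proof -
    have "v + t *\<^sub>R r \<in> S" using S v rS by (intro subspace_add subspace_scale) auto
    from max[OF this] have
      "(v + t *\<^sub>R r) \<bullet> (B *v (v + t *\<^sub>R r)) \<le> \<mu> * ((v + t *\<^sub>R r) \<bullet> (v + t *\<^sub>R r))"
      by (simp add: power2_norm_eq_inner)
    moreover have "v \<bullet> (B *v r) = r \<bullet> r"
      using rB symmetric_matrix_inner[OF sym, of v r] by (simp add: inner_commute)
    ultimately show ?thesis
      using rv rB vv mu
      by (simp add: matrix_vector_right_distrib matrix_vector_mult_scaleR inner_add_left inner_add_right
          inner_commute[of v r] algebra_simps power2_eq_square)
  qed
  then have "r \<bullet> r = 0" by (rule quadratic_le_linear_zero)
  then show ?thesis by (simp add: r_def)
qed

lemma ordered_eigenpairs_iff: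
  fixes B :: "real^'n^'n"
  shows "ordered_eigenpairs B \<nu> u \<longleftrightarrow>
    (\<forall>k\<in>{1..CARD('n)}. B *v u k = \<nu> k *\<^sub>R u k) \<and> orthonormal_upto DIM(real^'n) u \<and>
    (\<forall>k\<in>{1..CARD('n)}. \<forall>l\<in>{1..CARD('n)}. k \<le> l \<longrightarrow> \<nu> l \<le> \<nu> k)"
  by (simp add: ordered_eigenpairs_def orthonormal_upto_def)

text \<open>The next eigenvector is a maximizer of the quadratic form on the unit sphere of the orthogonal
  complement of the previous ones. The last conjunct says that the quadratic form on that complement
  is bounded by each eigenvalue found so far, which makes the sequence of eigenvalues decreasing.\<close>
lemma leading_eigenpairs_exist:
  fixes B :: "real^'n^'n"
  assumes sym: "transpose B = B" and "m \<le> CARD('n)"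
  shows "\<exists>\<nu> u. (\<forall>k\<in>{1..m}. B *v u k = \<nu> k *\<^sub>R u k) \<and> orthonormal_upto m u \<and>
    (\<forall>k\<in>{1..m}. \<forall>l\<in>{1..m}. k \<le> l \<longrightarrow> \<nu> l \<le> \<nu> k) \<and>
    (\<forall>x. (\<forall>k\<in>{1..m}. u k \<bullet> x = 0) \<longrightarrow> (\<forall>k\<in>{1..m}. x \<bullet> (B *v x) \<le> \<nu> k * (norm x)\<^sup>2))"
  using assms(2)
proof (induction m)
  case 0
  show ?case by (auto simp: orthonormal_upto_def)
next
  case (Suc m)
  then obtain \<nu> u where eig: "\<And>k. k \<in> {1..m} \<Longrightarrow> B *v u k = \<nu> k *\<^sub>R u k"
    and orth: "orthonormal_upto m u"
    and dec: "\<And>k l. k \<in> {1..m} \<Longrightarrow> l \<in> {1..m} \<Longrightarrow> k \<le> l \<Longrightarrow> \<nu> l \<le> \<nu> k"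
    and max: "\<And>x k. (\<And>k. k \<in> {1..m} \<Longrightarrow> u k \<bullet> x = 0) \<Longrightarrow> k \<in> {1..m} \<Longrightarrow>
      x \<bullet> (B *v x) \<le> \<nu> k * (norm x)\<^sup>2"
    by (metis Suc_leD)
  define S where "S = {x. \<forall>k\<in>{1..m}. u k \<bullet> x = 0}"
  have S: "subspace S" by (auto simp: S_def subspace_def inner_add_right)
  have "dim (u ` {1..m}) < DIM(real^'n)"
    using orthonormal_upto_dim_span[OF orth subset_refl] Suc.prems by simp
  then obtain z where z: "z \<noteq> 0" "\<And>y. y \<in> span (u ` {1..m}) \<Longrightarrow> orthogonal z y"
    using orthogonal_to_subspace_exists by blast
  have "z \<in> S" using z(2)[OF span_base] inner_commute[of z]  by (auto simp: S_def orthogonal_def)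
  then have "(1 / norm z) *\<^sub>R z \<in> S \<inter> sphere 0 1" using z S by (auto intro: subspace_scale)
  then have ne: "S \<inter> sphere 0 1 \<noteq> {}" by blast
  have comp: "compact (S \<inter> sphere 0 1)"
    by (intro closed_Int_compact closed_subspace S compact_sphere)
  have cont: "continuous_on (S \<inter> sphere 0 1) (\<lambda>x. x \<bullet> (B *v x))"
    by (intro continuous_intros)
  obtain v where v: "v \<in> S" "norm v = 1"
    and vmax: "\<And>y. y \<in> S \<Longrightarrow> norm y = 1 \<Longrightarrow> y \<bullet> (B *v y) \<le> v \<bullet> (B *v v)"
    using continuous_attains_sup[OF comp ne cont] by auto
  define \<mu> where "\<mu> = v \<bullet> (B *v v)"
  have mu: "x \<bullet> (B *v x) \<le> \<mu> * (norm x)\<^sup>2" if "x \<in> S" for x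
  proof (cases "x = 0")
    case False
    have "(1 / norm x) *\<^sub>R x \<in> S" using that S by (auto intro: subspace_scale)
    from vmax[OF this] False show ?thesis
      by (simp add: \<mu>_def matrix_vector_mult_scaleR divide_simps power2_eq_square)
  qed simp
  have inv: "B *v x \<in> S" if "x \<in> S" for x
    unfolding S_def
  proof (intro CollectI ballI)
    fix k assume "k \<in> {1..m}"
    then show "u k \<bullet> (B *v x) = 0"
      using that symmetric_matrix_inner[OF sym, of "u k" x] eig[of k] by (simp add: S_def)
  qed
  have Bv: "B *v v = \<mu> *\<^sub>R v"
    by (rule constrained_maximizer_is_eigenvector[OF sym S inv v \<mu>_def mu])
  have mu_le: "\<mu> \<le> \<nu> k" if "k \<in> {1..m}" for k
    using max[of v k] v that by (simp add: S_def \<mu>_def)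
  define \<nu>' where "\<nu>' = \<nu>(Suc m := \<mu>)"
  define u' where "u' = u(Suc m := v)"
  have split: "k \<in> {1..Suc m} \<longleftrightarrow> k \<in> {1..m} \<or> k = Suc m" for k by auto
  have "B *v u' k = \<nu>' k *\<^sub>R u' k" if "k \<in> {1..Suc m}" for k
    using that eig Bv by (auto simp: \<nu>'_def u'_def)
  moreover have "orthonormal_upto (Suc m) u'"
  proof -
    have "v \<bullet> v = 1" using v by (simp add: norm_eq_1)
    then show ?thesis
      using orthonormal_upto_inner[OF orth] v(1) unfolding orthonormal_upto_def split
      by (auto simp: u'_def S_def inner_commute)
  qed
  moreover have "\<nu>' l \<le> \<nu>' k" if "k \<in> {1..Suc m}" "l \<in> {1..Suc m}" "k \<le> l" for k l
    using that dec mu_le unfolding split by (auto simp: \<nu>'_def)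
  moreover have "x \<bullet> (B *v x) \<le> \<nu>' k * (norm x)\<^sup>2"
    if x: "\<forall>k\<in>{1..Suc m}. u' k \<bullet> x = 0" and k: "k \<in> {1..Suc m}" for x k
  proof -
    have 1: "u k \<bullet> x = 0" if "k \<in> {1..m}" for k using x that by (auto simp: u'_def dest!: bspec[of _ _ k])
    then have "x \<in> S" by (simp add: S_def)
    then show ?thesis using k mu max[OF 1] unfolding split by (auto simp: \<nu>'_def)
  qed
  ultimately show ?case by blast
qed

theorem spectral_theorem_ordered:
  fixes B :: "real^'n^'n"
  assumes "transpose B = B"
  obtains \<nu> u where "ordered_eigenpairs B \<nu> u"
  using leading_eigenpairs_exist[OF assms order_refl] by (auto simp: ordered_eigenpairs_iff)

lemma eigen_coefficient:
  fixes B :: "real^'n^'n"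
  assumes "transpose B = B" "B *v u = \<nu> *\<^sub>R u"
  shows "(B *v x) \<bullet> u = \<nu> * (x \<bullet> u)"
  using symmetric_matrix_inner[OF assms(1), of x u] assms(2) by simp

lemma eigenbasis_mult:
  fixes B :: "real^'n^'n"
  assumes "ordered_eigenpairs B \<nu> u"
  shows "B *v x = (\<Sum>k=1..CARD('n). (\<nu> k * (x \<bullet> u k)) *\<^sub>R u k)"
proof -
  have "B *v x = B *v (\<Sum>k=1..CARD('n). (x \<bullet> u k) *\<^sub>R u k)"
    using orthonormal_expansion[of u x] assms by (simp add: ordered_eigenpairs_iff)
  also have "\<dots> = (\<Sum>k=1..CARD('n). (x \<bullet> u k) *\<^sub>R (B *v u k))"
    by (simp add: linear_sum[OF matrix_vector_mul_linear] matrix_vector_mult_scaleR)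
  also have "\<dots> = (\<Sum>k=1..CARD('n). (\<nu> k * (x \<bullet> u k)) *\<^sub>R u k)"
    using assms by (intro sum.cong) (auto simp: ordered_eigenpairs_def mult.commute)
  finally show ?thesis .
qed

lemma eigenbasis_quadratic_form:
  fixes B :: "real^'n^'n"
  assumes "ordered_eigenpairs B \<nu> u"
  shows "x \<bullet> (B *v x) = (\<Sum>k=1..CARD('n). \<nu> k * (x \<bullet> u k)\<^sup>2)"
  by (simp add: eigenbasis_mult[OF assms] inner_sum_right power2_eq_square mult.assoc)

section \<open>Perturbation of eigenvalues and eigenvectors\<close>

text \<open>The span of the first \<open>k\<close> eigenvectors of \<open>B'\<close> and the span of the eigenvectors \<open>k, \<dots>, n\<close> of
  \<open>B\<close> have dimensions adding up to \<open>n + 1\<close>, so they share a nonzero vector \<open>x\<close>. On the first space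
  the form of \<open>B'\<close> is at least \<open>\<nu>' k\<close>, on the second the form of \<open>B\<close> is at most \<open>\<nu> k\<close>, and the two
  forms differ by at most the norm of \<open>B - B'\<close>.\<close>
lemma Weyl_inequality:
  fixes B B' :: "real^'n^'n"
  assumes e: "ordered_eigenpairs B \<nu> u" and e': "ordered_eigenpairs B' \<nu>' u'"
    and k: "k \<in> {1..CARD('n)}"
  shows "\<nu>' k \<le> \<nu> k + norm (B - B')"
proof -
  let ?n = "CARD('n)"
  have on: "orthonormal_upto DIM(real^'n) u" and on': "orthonormal_upto DIM(real^'n) u'"
    using e e' by (auto simp: ordered_eigenpairs_iff)
  define S where "S = span (u' ` {1..k})"
  define T where "T = span (u ` {k..?n})"
  have "dim S = k" "dim T = ?n + 1 - k"
    using orthonormal_upto_dim_span[OF on', of "{1..k}"] orthonormal_upto_dim_span[OF on, of "{k..?n}"] k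
    by (auto simp: S_def T_def)
  moreover have "dim {x + y |x y. x \<in> S \<and> y \<in> T} + dim (S \<inter> T) = dim S + dim T"
    by (rule dim_sums_Int) (auto simp: S_def T_def)
  moreover have "dim {x + y |x y. x \<in> S \<and> y \<in> T} \<le> ?n"
    using dim_subset_UNIV[of "{x + y |x y. x \<in> S \<and> y \<in> T}"] by simp
  ultimately have "dim (S \<inter> T) > 0" using k by (simp only: atLeastAtMost_iff)
  then have "\<not> S \<inter> T \<subseteq> {0}" using dim_eq_0[of "S \<inter> T"] by linarith
  then obtain x where x: "x \<in> S" "x \<in> T" "x \<noteq> 0" by blast
  have vanish: "x \<bullet> w l = 0" if "x \<in> span (w ` I)" "l \<in> {1..?n} - I" "I \<subseteq> {1..?n}"
      "orthonormal_upto DIM(real^'n) w" for w l I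
  proof -
    have "orthogonal (w l) x"
      using that by (intro orthogonal_to_span[OF that(1)])
        (auto simp: orthogonal_def orthonormal_upto_def subset_iff)
    then show ?thesis by (simp add: orthogonal_def inner_commute)
  qed
  have "\<nu>' k * (norm x)\<^sup>2 \<le> x \<bullet> (B' *v x)"
    unfolding orthonormal_Parseval_norm[OF on'] eigenbasis_quadratic_form[OF e'] sum_distrib_left
  proof (simp, intro sum_mono)
    fix l assume l: "l \<in> {Suc 0..?n}"
    show "\<nu>' k * (x \<bullet> u' l)\<^sup>2 \<le> \<nu>' l * (x \<bullet> u' l)\<^sup>2"
    proof (cases "l \<le> k")
      case True
      then show ?thesis using e' k l by (intro mult_right_mono) (auto simp: ordered_eigenpairs_iff)
    next
      case False
      then show ?thesis using vanish[OF x(1)[unfolded S_def], of l] on' l k by auto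
    qed
  qed
  moreover have "x \<bullet> (B *v x) \<le> \<nu> k * (norm x)\<^sup>2"
    unfolding orthonormal_Parseval_norm[OF on] eigenbasis_quadratic_form[OF e] sum_distrib_left
  proof (simp, intro sum_mono)
    fix l assume l: "l \<in> {Suc 0..?n}"
    show "\<nu> l * (x \<bullet> u l)\<^sup>2 \<le> \<nu> k * (x \<bullet> u l)\<^sup>2"
    proof (cases "k \<le> l")
      case True
      then show ?thesis using e k l by (intro mult_right_mono) (auto simp: ordered_eigenpairs_iff)
    next
      case False
      then show ?thesis using vanish[OF x(2)[unfolded T_def], of l] on l k by auto
    qed
  qed
  moreover have "x \<bullet> (B' *v x) - x \<bullet> (B *v x) \<le> norm (B - B') * (norm x)\<^sup>2"
  proof -
    have "x \<bullet> (B' *v x) - x \<bullet> (B *v x) = x \<bullet> ((B' - B) *v x)"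
      by (simp add: matrix_vector_mult_diff_rdistrib inner_diff_right)
    also have "\<dots> \<le> norm x * (norm (B' - B) * norm x)"
      by (rule order_trans[OF norm_cauchy_schwarz mult_left_mono[OF norm_matrix_vector_le]]) simp
    finally show ?thesis by (simp add: power2_eq_square norm_minus_commute mult_ac)
  qed
  ultimately have "\<nu>' k * (norm x)\<^sup>2 \<le> (\<nu> k + norm (B - B')) * (norm x)\<^sup>2"
    by (simp add: algebra_simps)
  then show ?thesis using x(3) by simp
qed

text \<open>The factor 2 leaves room for an eigenvalue of the perturbed matrix: if it is within \<open>g\<close> of
  \<open>\<nu> k\<close>, it is still at distance at least \<open>g\<close> from every \<open>\<nu> l\<close> different from \<open>\<nu> k\<close>.\<close>
lemma eigenvalue_gap:
  fixes \<nu> :: "nat \<Rightarrow> real"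
  obtains g where "g > 0" "\<And>k l. k \<in> {1..n} \<Longrightarrow> l \<in> {1..n} \<Longrightarrow> \<nu> k \<noteq> \<nu> l \<Longrightarrow> 2 * g \<le> \<bar>\<nu> k - \<nu> l\<bar>"
proof -
  define G where "G = insert 1 {\<bar>\<nu> k - \<nu> l\<bar> |k l. k \<in> {1..n} \<and> l \<in> {1..n} \<and> \<nu> k \<noteq> \<nu> l}"
  have "G \<subseteq> insert 1 ((\<lambda>(k, l). \<bar>\<nu> k - \<nu> l\<bar>) ` ({1..n} \<times> {1..n}))"
    unfolding G_def by auto
  then have fin: "finite G" by (rule finite_subset) auto
  have "Min G > 0" using fin by (subst Min_gr_iff) (auto simp: G_def)
  moreover have "Min G \<le> \<bar>\<nu> k - \<nu> l\<bar>" if "k \<in> {1..n}" "l \<in> {1..n}" "\<nu> k \<noteq> \<nu> l" for k l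
    using that fin by (intro Min_le) (auto simp: G_def)
  ultimately show thesis using that[of "Min G / 2"] by auto
qed

text \<open>Gram-Schmidt, applied to eigenvectors \<open>w k\<close> close to an orthonormal family \<open>v\<close>. It loses only a
  constant factor, since the inner products to be removed are of order \<open>\<eta>\<close>. It also preserves the
  eigenvalue equations: eigenvectors of a symmetric matrix for different eigenvalues are orthogonal,
  so the process subtracts from \<open>w k\<close> multiples of vectors in the same eigenspace only. The bound
  \<open>\<eta>\<^sub>0\<close> keeps the vectors that are to be normalized away from zero.\<close>
lemma orthonormalize_near_eigenvectors:
  fixes B :: "real^'n^'n"
  assumes sym: "transpose B = B"
  shows "\<exists>C\<ge>0. \<exists>\<eta>\<^sub>0>0. \<forall>\<eta> v w. 0 \<le> \<eta> \<longrightarrow> \<eta> \<le> \<eta>\<^sub>0 \<longrightarrow> orthonormal_upto m v \<longrightarrow>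
    (\<forall>k\<in>{1..m}. B *v w k = \<nu> k *\<^sub>R w k \<and> norm (w k - v k) \<le> \<eta>) \<longrightarrow>
    (\<exists>u. orthonormal_upto m u \<and> (\<forall>k\<in>{1..m}. B *v u k = \<nu> k *\<^sub>R u k \<and> norm (u k - v k) \<le> C * \<eta>))"
  (is "\<exists>C\<ge>0. \<exists>\<eta>\<^sub>0>0. ?P m C \<eta>\<^sub>0")
proof (induction m)
  case 0
  show ?case by (rule exI[of _ 0], simp, rule exI[of _ 1]) (simp add: orthonormal_upto_def)
next
  case (Suc m)
  then obtain C \<eta>0 where C: "C \<ge> 0" "\<eta>0 > 0"
    and IH: "?P m C \<eta>0"
    by (elim exE conjE) (rule that)
  define c where "c = 1 + real m * (1 + C)"
  have c: "c \<ge> 1" using C by (simp add: c_def)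
  have split: "k \<in> {1..Suc m} \<longleftrightarrow> k \<in> {1..m} \<or> k = Suc m" for k by auto
  have near: "\<exists>u. orthonormal_upto (Suc m) u \<and>
      (\<forall>k\<in>{1..Suc m}. B *v u k = \<nu> k *\<^sub>R u k \<and> norm (u k - v k) \<le> (C + 2 * c) * \<eta>)"
    if eta: "0 \<le> \<eta>" "\<eta> \<le> min \<eta>0 (1 / (2 * c))" and ov: "orthonormal_upto (Suc m) v"
      and w: "\<And>k. k \<in> {1..Suc m} \<Longrightarrow> B *v w k = \<nu> k *\<^sub>R w k \<and> norm (w k - v k) \<le> \<eta>" for \<eta> v w
  proof -
    have "orthonormal_upto m v" using ov unfolding orthonormal_upto_def by auto
    then obtain u where ou: "orthonormal_upto m u"
      and u: "\<And>k. k \<in> {1..m} \<Longrightarrow> B *v u k = \<nu> k *\<^sub>R u k"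
      and uv: "\<And>k. k \<in> {1..m} \<Longrightarrow> norm (u k - v k) \<le> C * \<eta>"
      using IH[rule_format, of \<eta> v w] eta w by auto
    let ?v = "v (Suc m)" and ?w = "w (Suc m)" and ?\<nu> = "\<nu> (Suc m)"
    have Bw: "B *v ?w = ?\<nu> *\<^sub>R ?w" and wv: "norm (?w - ?v) \<le> \<eta>" using w[of "Suc m"] by auto
    have nv: "norm ?v = 1" using orthonormal_upto_norm[OF ov] by simp
    define a where "a k = ?w \<bullet> u k" for k
    have a_le: "\<bar>a k\<bar> \<le> (1 + C) * \<eta>" if k: "k \<in> {1..m}" for k
    proof -
      have "?v \<bullet> v k = 0" using orthonormal_upto_inner[OF ov, of "Suc m" k] k by auto
      then have "a k = (?w - ?v) \<bullet> u k + ?v \<bullet> (u k - v k)"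
        by (simp add: a_def inner_diff_left inner_diff_right)
      moreover have "\<bar>(?w - ?v) \<bullet> u k\<bar> \<le> \<eta>"
        using Cauchy_Schwarz_ineq2[of "?w - ?v" "u k"] wv orthonormal_upto_norm[OF ou k] by simp
      moreover have "\<bar>?v \<bullet> (u k - v k)\<bar> \<le> C * \<eta>"
        using Cauchy_Schwarz_ineq2[of ?v "u k - v k"] nv uv[OF k] by simp
      ultimately show ?thesis by (simp add: algebra_simps)
    qed
    define w' where "w' = ?w - (\<Sum>k=1..m. a k *\<^sub>R u k)"
    have "norm (\<Sum>k=1..m. a k *\<^sub>R u k) \<le> (\<Sum>k=1..m. (1 + C) * \<eta>)"
      using a_le orthonormal_upto_norm[OF ou] by (intro sum_norm_le) auto
    then have "norm (w' - ?v) \<le> \<eta> + real m * ((1 + C) * \<eta>)"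
      using wv norm_triangle_ineq4[of "?w - ?v" "\<Sum>k=1..m. a k *\<^sub>R u k"]
      by (simp add: w'_def algebra_simps)
    then have w'v: "norm (w' - ?v) \<le> c * \<eta>" by (simp add: c_def algebra_simps)
    have "c * \<eta> \<le> 1 / 2" using eta c by (simp add: field_simps)
    moreover have dist1: "\<bar>norm w' - 1\<bar> \<le> c * \<eta>"
      using norm_triangle_ineq3[of w' ?v] w'v nv by simp
    ultimately have w'0: "norm w' > 0" by linarith
    define x where "x = (1 / norm w') *\<^sub>R w'"
    have nx: "norm x = 1" using w'0 by (simp add: x_def)
    have "x - w' = (1 / norm w' - 1) *\<^sub>R w'" by (simp add: x_def algebra_simps)
    then have "norm (x - w') = \<bar>1 / norm w' - 1\<bar> * norm w'" by simp
    also have "\<dots> = \<bar>(1 / norm w' - 1) * norm w'\<bar>" by (simp add: abs_mult)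
    also have "\<dots> = \<bar>norm w' - 1\<bar>" using w'0 by (simp add: left_diff_distrib abs_minus_commute)
    finally have "norm (x - w') \<le> c * \<eta>" using dist1 by simp
    moreover have "norm (x - ?v) \<le> norm (x - w') + norm (w' - ?v)"
      using norm_triangle_ineq[of "x - w'" "w' - ?v"] by simp
    ultimately have xv: "norm (x - ?v) \<le> 2 * c * \<eta>" using w'v by linarith
    have xu: "x \<bullet> u k = 0" if k: "k \<in> {1..m}" for k
    proof -
      have "(\<Sum>l=1..m. a l * (u l \<bullet> u k)) = (\<Sum>l=1..m. if l = k then a l else 0)"
        using orthonormal_upto_inner[OF ou _ k] by (intro sum.cong) auto
      also have "\<dots> = a k" using k by (simp add: sum.delta)
      finally show ?thesis by (simp add: x_def w'_def inner_diff_left inner_sum_left a_def)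
    qed
    (* Either a k = 0, or u k belongs to the same eigenspace as w (Suc m). *)
    have "a k *\<^sub>R (B *v u k) = ?\<nu> *\<^sub>R (a k *\<^sub>R u k)" if k: "k \<in> {1..m}" for k
    proof -
      have "?\<nu> * a k = \<nu> k * a k"
        using eigen_coefficient[OF sym u[OF k], of ?w] Bw by (simp add: a_def)
      moreover have "a k *\<^sub>R (B *v u k) = (\<nu> k * a k) *\<^sub>R u k" by (simp add: u[OF k] mult.commute)
      ultimately show ?thesis by (simp only: scaleR_scaleR)
    qed
    then have "B *v w' = ?\<nu> *\<^sub>R w'"
      by (simp add: w'_def matrix_vector_mult_diff_distrib linear_sum[OF matrix_vector_mul_linear]
          matrix_vector_mult_scaleR Bw scaleR_right_diff_distrib scaleR_sum_right)
    then have Bx: "B *v x = ?\<nu> *\<^sub>R x" by (simp add: x_def matrix_vector_mult_scaleR)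
    define u' where "u' = u(Suc m := x)"
    have "x \<bullet> x = 1" using nx by (simp add: norm_eq_1)
    moreover have "u k \<bullet> x = 0" if "k \<in> {1..m}" for k using xu[OF that] by (simp add: inner_commute)
    ultimately have "orthonormal_upto (Suc m) u'"
      using orthonormal_upto_inner[OF ou] xu unfolding orthonormal_upto_def split
      by (auto simp: u'_def)
    moreover have "B *v u' k = \<nu> k *\<^sub>R u' k \<and> norm (u' k - v k) \<le> (C + 2 * c) * \<eta>"
      if k: "k \<in> {1..Suc m}" for k
    proof (cases "k = Suc m")
      case True
      have "2 * c * \<eta> \<le> (C + 2 * c) * \<eta>" using C eta by (simp add: mult_right_mono)
      then show ?thesis using True Bx xv by (simp add: u'_def)
    next
      case False
      then have k': "k \<in> {1..m}" using k by auto
      have "C * \<eta> \<le> (C + 2 * c) * \<eta>" using c eta by (simp add: mult_right_mono)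
      then show ?thesis using False u[OF k'] uv[OF k'] by (simp add: u'_def)
    qed
    ultimately show ?thesis by blast
  qed
  have "0 \<le> C + 2 * c" "0 < min \<eta>0 (1 / (2 * c))" using C c by auto
  moreover have "?P (Suc m) (C + 2 * c) (min \<eta>0 (1 / (2 * c)))"
    by (intro allI impI) (rule near, assumption, assumption, assumption, drule (1) bspec, assumption)
  ultimately show ?case by (intro exI conjI)
qed

text \<open>The eigenbasis \<open>u\<close> of \<open>B\<close> has to be chosen depending on \<open>u'\<close>: if \<open>B\<close> has a repeated
  eigenvalue, arbitrarily small perturbations select quite different bases of its eigenspace. For
  \<open>l\<close> with \<open>\<nu> l \<noteq> \<nu> k\<close>, the component of \<open>u' k\<close> along the eigenvector \<open>u\<^sub>0 l\<close> is computed from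
  \<open>(\<nu> l - \<nu>' k) (u' k \<bullet> u\<^sub>0 l) = ((B - B') u' k) \<bullet> u\<^sub>0 l\<close>, where the first factor is bounded below
  by the gap. A perturbation that is too large for this argument satisfies the bound trivially,
  because two unit vectors have distance at most 2.\<close>
theorem eigenvector_perturbation:
  fixes B :: "real^'n^'n"
  assumes sym: "transpose B = B" and e0: "ordered_eigenpairs B \<nu> u\<^sub>0"
  obtains C where "C \<ge> 0"
    "\<And>B' \<nu>' u'. ordered_eigenpairs B' \<nu>' u' \<Longrightarrow>
      \<exists>u. ordered_eigenpairs B \<nu> u \<and> (\<forall>k\<in>{1..CARD('n)}. norm (u k - u' k) \<le> C * norm (B - B'))"
proof -
  let ?n = "CARD('n)"
  obtain g where g: "g > 0"
    and gap: "\<And>k l. k \<in> {1..?n} \<Longrightarrow> l \<in> {1..?n} \<Longrightarrow> \<nu> k \<noteq> \<nu> l \<Longrightarrow> 2 * g \<le> \<bar>\<nu> k - \<nu> l\<bar>"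
    using eigenvalue_gap[of ?n \<nu>] by blast
  obtain C \<eta>0 where C: "C \<ge> 0" "\<eta>0 > 0"
    and orthonormalize: "\<forall>\<eta> v w. 0 \<le> \<eta> \<longrightarrow> \<eta> \<le> \<eta>0 \<longrightarrow> orthonormal_upto ?n v \<longrightarrow>
      (\<forall>k\<in>{1..?n}. B *v w k = \<nu> k *\<^sub>R w k \<and> norm (w k - v k) \<le> \<eta>) \<longrightarrow>
      (\<exists>u. orthonormal_upto ?n u \<and> (\<forall>k\<in>{1..?n}. B *v u k = \<nu> k *\<^sub>R u k \<and> norm (u k - v k) \<le> C * \<eta>))"
    using orthonormalize_near_eigenvectors[OF sym, of ?n \<nu>] by (elim exE conjE) (rule that)
  have on: "orthonormal_upto DIM(real^'n) u\<^sub>0" using e0 by (simp add: ordered_eigenpairs_iff)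
  (* Below g, eigenvalues move by at most g; below the other bound, the projections are close enough
     to orthonormal for Gram-Schmidt. *)
  define \<rho> where "\<rho> = min g (\<eta>0 * g / ?n)"
  have \<rho>: "\<rho> > 0" using g C by (simp add: \<rho>_def)
  define K where "K = C * (?n / g) + 2 / \<rho>"
  have K: "K \<ge> 0" "C * (?n / g) \<le> K" "2 / \<rho> \<le> K" using C g \<rho> by (simp_all add: K_def)
  have "\<exists>u. ordered_eigenpairs B \<nu> u \<and> (\<forall>k\<in>{1..?n}. norm (u k - u' k) \<le> K * norm (B - B'))"
    if e': "ordered_eigenpairs B' \<nu>' u'" for B' \<nu>' u'
  proof -
    define E where "E = norm (B - B')"
    have on': "orthonormal_upto ?n u'" using e' by (simp add: ordered_eigenpairs_iff)
    show ?thesis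
    proof (cases "E \<le> \<rho>")
      case True
      (* The orthogonal projection of u' k to the eigenspace of B for \<nu> k. *)
      define w where "w k = (\<Sum>l | l \<in> {1..?n} \<and> \<nu> l = \<nu> k. (u' k \<bullet> u\<^sub>0 l) *\<^sub>R u\<^sub>0 l)" for k
      have "B *v w k = \<nu> k *\<^sub>R w k \<and> norm (w k - u' k) \<le> ?n / g * E" if k: "k \<in> {1..?n}" for k
      proof
        have "B *v w k = (\<Sum>l | l \<in> {1..?n} \<and> \<nu> l = \<nu> k. (u' k \<bullet> u\<^sub>0 l) *\<^sub>R (B *v u\<^sub>0 l))"
          by (simp add: w_def linear_sum[OF matrix_vector_mul_linear] matrix_vector_mult_scaleR)
        also have "\<dots> = (\<Sum>l | l \<in> {1..?n} \<and> \<nu> l = \<nu> k. \<nu> k *\<^sub>R ((u' k \<bullet> u\<^sub>0 l) *\<^sub>R u\<^sub>0 l))"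
          using e0 by (intro sum.cong) (auto simp: ordered_eigenpairs_def mult.commute)
        finally show "B *v w k = \<nu> k *\<^sub>R w k" by (simp add: w_def scaleR_sum_right)
        have "\<bar>\<nu> k - \<nu>' k\<bar> \<le> g"
          using Weyl_inequality[OF e0 e' k] Weyl_inequality[OF e' e0 k] True
          by (simp add: E_def \<rho>_def norm_minus_commute abs_le_iff)
        have small: "\<bar>u' k \<bullet> u\<^sub>0 l\<bar> \<le> E / g" if l: "l \<in> {1..?n}" "\<nu> l \<noteq> \<nu> k" for l
        proof -
          have "g \<le> \<bar>\<nu> l - \<nu>' k\<bar>"
            using gap[OF l(1) k l(2)] \<open>\<bar>\<nu> k - \<nu>' k\<bar> \<le> g\<close> by linarith
          then have "g * \<bar>u' k \<bullet> u\<^sub>0 l\<bar> \<le> \<bar>\<nu> l - \<nu>' k\<bar> * \<bar>u' k \<bullet> u\<^sub>0 l\<bar>"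
            by (rule mult_right_mono) simp
          also have "\<dots> = \<bar>((B - B') *v u' k) \<bullet> u\<^sub>0 l\<bar>"
            using eigen_coefficient[OF sym, of "u\<^sub>0 l" "\<nu> l" "u' k"] e0 e' k l
            by (simp add: ordered_eigenpairs_def matrix_vector_mult_diff_rdistrib inner_diff_left
                left_diff_distrib abs_mult[symmetric])
          also have "\<dots> \<le> norm ((B - B') *v u' k)"
            using Cauchy_Schwarz_ineq2[of "(B - B') *v u' k" "u\<^sub>0 l"] orthonormal_upto_norm[OF on, of l] l
            by simp
          also have "\<dots> \<le> E"
            using norm_matrix_vector_le[of "B - B'" "u' k"] orthonormal_upto_norm[OF on' k] by (simp add: E_def)
          finally show ?thesis using g by (simp add: field_simps)
        qed
        define r where "r = (\<Sum>l | l \<in> {1..?n} \<and> \<nu> l \<noteq> \<nu> k. (u' k \<bullet> u\<^sub>0 l) *\<^sub>R u\<^sub>0 l)"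
        have "u' k = (\<Sum>l\<in>{1..?n}. (u' k \<bullet> u\<^sub>0 l) *\<^sub>R u\<^sub>0 l)"
          using orthonormal_expansion[OF on, of "u' k"] by simp
        also have "{1..?n} = {l. l \<in> {1..?n} \<and> \<nu> l = \<nu> k} \<union> {l. l \<in> {1..?n} \<and> \<nu> l \<noteq> \<nu> k}"
          by blast
        also have "(\<Sum>l\<in>\<dots>. (u' k \<bullet> u\<^sub>0 l) *\<^sub>R u\<^sub>0 l) = w k + r"
          unfolding w_def r_def by (rule sum.union_disjoint) auto
        finally have "norm (w k - u' k) = norm r" by simp
        also have "\<dots> \<le> (\<Sum>l | l \<in> {1..?n} \<and> \<nu> l \<noteq> \<nu> k. E / g)"
          unfolding r_def using small orthonormal_upto_norm[OF on] by (intro sum_norm_le) auto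
        also have "\<dots> \<le> (\<Sum>l\<in>{1..?n}. E / g)"
          using g by (intro sum_mono2) (auto simp: E_def)
        finally show "norm (w k - u' k) \<le> ?n / g * E" by simp
      qed
      moreover have "0 \<le> ?n / g * E" "?n / g * E \<le> \<eta>0"
        using True g by (auto simp: E_def \<rho>_def field_simps)
      ultimately obtain u where u: "orthonormal_upto ?n u"
        "\<And>k. k \<in> {1..?n} \<Longrightarrow> B *v u k = \<nu> k *\<^sub>R u k \<and> norm (u k - u' k) \<le> C * (?n / g * E)"
        using orthonormalize[rule_format, of "?n / g * E" u' w] on' by auto
      have "C * (?n / g * E) \<le> K * E"
        using mult_right_mono[OF K(2), of E] by (simp add: E_def)
      then have "norm (u k - u' k) \<le> K * E" if "k \<in> {1..?n}" for k using u(2)[OF that] by linarith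
      moreover have "ordered_eigenpairs B \<nu> u"
        using u e0 by (auto simp: ordered_eigenpairs_iff)
      ultimately show ?thesis unfolding E_def by blast
    next
      case False
      have "norm (u\<^sub>0 k - u' k) \<le> K * E" if k: "k \<in> {1..?n}" for k
      proof -
        have "norm (u\<^sub>0 k - u' k) \<le> 2"
          using norm_triangle_ineq4[of "u\<^sub>0 k" "u' k"] orthonormal_upto_norm[OF on, of k]
            orthonormal_upto_norm[OF on' k] k by simp
        also have "\<dots> \<le> 2 / \<rho> * E" using False \<rho> by (simp add: field_simps)
        also have "\<dots> \<le> K * E" by (rule mult_right_mono[OF K(3)]) (simp add: E_def)
        finally show ?thesis .
      qed
      then show ?thesis using e0 unfolding E_def by blast
    qed
  qed
  then show thesis using that[OF K(1)] by blast
qed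

section \<open>Perturbation of scaled eigenvectors\<close>

lemma sqrt_diff_sq_le:
  fixes a b :: real
  assumes "0 \<le> a" "0 \<le> b"
  shows "(sqrt a - sqrt b)\<^sup>2 \<le> \<bar>a - b\<bar>"
proof -
  have "\<bar>sqrt a - sqrt b\<bar> \<le> \<bar>sqrt a + sqrt b\<bar>" using assms by (auto simp: abs_le_iff)
  then have "\<bar>sqrt a - sqrt b\<bar> * \<bar>sqrt a - sqrt b\<bar> \<le> \<bar>sqrt a - sqrt b\<bar> * \<bar>sqrt a + sqrt b\<bar>"
    by (rule mult_left_mono) simp
  then have "(sqrt a - sqrt b)\<^sup>2 \<le> \<bar>sqrt a - sqrt b\<bar> * \<bar>sqrt a + sqrt b\<bar>"
    by (simp add: power2_eq_square)
  also have "\<dots> = \<bar>(sqrt a - sqrt b) * (sqrt a + sqrt b)\<bar>" by (simp only: abs_mult)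
  also have "(sqrt a - sqrt b) * (sqrt a + sqrt b) = a - b" using assms by (simp add: algebra_simps)
  finally show ?thesis .
qed

lemma sqrt_diff_sq_le_square:
  fixes a b :: real
  assumes "0 < a" "0 \<le> b"
  shows "(sqrt a - sqrt b)\<^sup>2 \<le> (a - b)\<^sup>2 / a"
proof -
  have "a * (sqrt a - sqrt b)\<^sup>2 \<le> (sqrt a + sqrt b)\<^sup>2 * (sqrt a - sqrt b)\<^sup>2"
    using assms by (intro mult_right_mono) (auto simp: power2_sum)
  also have "\<dots> = (a - b)\<^sup>2"
    using assms by (simp add: power_mult_distrib[symmetric] algebra_simps)
  finally show ?thesis using assms by (simp add: field_simps)
qed

lemma scaled_vector_diff_sq:
  fixes x y :: "'a::real_normed_vector"
  assumes "norm y = 1"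
  shows "(norm (s *\<^sub>R x - t *\<^sub>R y))\<^sup>2 \<le> 2 * s\<^sup>2 * (norm (x - y))\<^sup>2 + 2 * (s - t)\<^sup>2"
proof -
  have "s *\<^sub>R x - t *\<^sub>R y = s *\<^sub>R (x - y) + (s - t) *\<^sub>R y" by (simp add: algebra_simps)
  then have "norm (s *\<^sub>R x - t *\<^sub>R y) \<le> \<bar>s\<bar> * norm (x - y) + \<bar>s - t\<bar>"
    using norm_triangle_ineq[of "s *\<^sub>R (x - y)" "(s - t) *\<^sub>R y"] assms by simp
  then have "(norm (s *\<^sub>R x - t *\<^sub>R y))\<^sup>2 \<le> (\<bar>s\<bar> * norm (x - y) + \<bar>s - t\<bar>)\<^sup>2"
    by (rule power_mono) simp
  also have "\<dots> \<le> 2 * (\<bar>s\<bar> * norm (x - y))\<^sup>2 + 2 * \<bar>s - t\<bar>\<^sup>2"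
    using sum_squares_bound[of "\<bar>s\<bar> * norm (x - y)" "\<bar>s - t\<bar>"] by (simp add: power2_sum)
  finally show ?thesis by (simp add: power_mult_distrib)
qed

text \<open>For the linear bound, one factor \<open>|u k - u' k|\<close> of the square is estimated by 2 and the other by
  the perturbation theorem, which makes this bound hold for perturbations of every size.\<close>
lemma scaled_eigenvectors_perturbation:
  fixes B :: "real^'n^'n"
  assumes sym: "transpose B = B" and e0: "ordered_eigenpairs B \<nu> u\<^sub>0" and d: "d \<in> {1..CARD('n)}"
  obtains C where "C > 0"
    "\<And>B' \<nu>' u'. ordered_eigenpairs B' \<nu>' u' \<Longrightarrow>
      \<exists>u. ordered_eigenpairs B \<nu> u \<and>
        (let err = \<Sum>k=1..d. (norm (sqrt (max (\<nu> k) 0) *\<^sub>R u k - sqrt (max (\<nu>' k) 0) *\<^sub>R u' k))\<^sup>2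
         in err \<le> C * norm (B - B') \<and> (\<nu> d > 0 \<longrightarrow> err \<le> C * (norm (B - B'))\<^sup>2))"
proof -
  let ?n = "CARD('n)"
  obtain K where K: "K \<ge> 0" and pert: "\<And>B' \<nu>' u'. ordered_eigenpairs B' \<nu>' u' \<Longrightarrow>
      \<exists>u. ordered_eigenpairs B \<nu> u \<and> (\<forall>k\<in>{1..?n}. norm (u k - u' k) \<le> K * norm (B - B'))"
    using eigenvector_perturbation[OF sym e0] by blast
  define a where "a = max (\<nu> 1) 0"
  have "\<nu> k \<le> \<nu> 1" if "k \<in> {1..d}" for k
    using e0 d that by (auto simp: ordered_eigenpairs_def)
  then have a: "a \<ge> 0" "\<And>k. k \<in> {1..d} \<Longrightarrow> max (\<nu> k) 0 \<le> a"
    unfolding a_def by (simp, intro max.mono) auto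
  (* C1 serves the linear and C2 the quadratic bound of each of the d terms. If \<nu> d > 0, then
     1 / \<nu> d bounds the squared difference quotient of sqrt between the positive parts of \<nu> k and \<nu>' k. *)
  define C1 where "C1 = 4 * a * K + 2"
  define C2 where "C2 = 2 * a * K\<^sup>2 + 2 / \<bar>\<nu> d\<bar>"
  define C where "C = real d * (C1 + C2)"
  have C12: "C1 > 0" "C2 \<ge> 0" using a K by (auto simp: C1_def C2_def intro: add_nonneg_pos)
  then have C: "C > 0" using d by (simp add: C_def)
  have "\<exists>u. ordered_eigenpairs B \<nu> u \<and>
        (let err = \<Sum>k=1..d. (norm (sqrt (max (\<nu> k) 0) *\<^sub>R u k - sqrt (max (\<nu>' k) 0) *\<^sub>R u' k))\<^sup>2
         in err \<le> C * norm (B - B') \<and> (\<nu> d > 0 \<longrightarrow> err \<le> C * (norm (B - B'))\<^sup>2))"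
    if e': "ordered_eigenpairs B' \<nu>' u'" for B' \<nu>' u'
  proof -
    obtain u where e: "ordered_eigenpairs B \<nu> u"
      and u: "\<And>k. k \<in> {1..?n} \<Longrightarrow> norm (u k - u' k) \<le> K * norm (B - B')"
      using pert[OF e'] by blast
    define E where "E = norm (B - B')"
    have E: "E \<ge> 0" by (simp add: E_def)
    define t where "t k = (norm (sqrt (max (\<nu> k) 0) *\<^sub>R u k - sqrt (max (\<nu>' k) 0) *\<^sub>R u' k))\<^sup>2" for k
    have bound: "t k \<le> C1 * E \<and> (\<nu> d > 0 \<longrightarrow> t k \<le> C2 * E\<^sup>2)" if k: "k \<in> {1..d}" for k
    proof -
      have kn: "k \<in> {1..?n}" using k d by auto
      have n1: "norm (u k) = 1" "norm (u' k) = 1"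
        using e e' kn orthonormal_upto_norm[of ?n u k] orthonormal_upto_norm[of ?n u' k]
        by (auto simp: ordered_eigenpairs_iff)
      have ev: "\<bar>max (\<nu> k) 0 - max (\<nu>' k) 0\<bar> \<le> E"
        using Weyl_inequality[OF e e' kn] Weyl_inequality[OF e' e kn] E
        by (auto simp: E_def norm_minus_commute max_def)
      let ?x = "(norm (u k - u' k))\<^sup>2" and ?s = "(sqrt (max (\<nu> k) 0) - sqrt (max (\<nu>' k) 0))\<^sup>2"
      have t: "t k \<le> 2 * max (\<nu> k) 0 * ?x + 2 * ?s"
        using scaled_vector_diff_sq[OF n1(2), of "sqrt (max (\<nu> k) 0)" "u k" "sqrt (max (\<nu>' k) 0)"]
        by (simp add: t_def)
      also have "\<dots> \<le> 2 * a * ?x + 2 * ?s"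
        using a k by (intro add_right_mono mult_right_mono) auto
      finally have t: "t k \<le> 2 * a * ?x + 2 * ?s" .
      have "?x \<le> 2 * (K * E)"
        unfolding power2_eq_square using u[OF kn] norm_triangle_ineq4[of "u k" "u' k"] n1
        by (intro mult_mono) (auto simp: E_def)
      then have "2 * a * ?x \<le> 2 * a * (2 * (K * E))" using a by (intro mult_left_mono) auto
      moreover have "?s \<le> E" using sqrt_diff_sq_le[of "max (\<nu> k) 0" "max (\<nu>' k) 0"] ev by simp
      ultimately have 1: "t k \<le> C1 * E" using t by (simp add: C1_def algebra_simps)
      have 2: "t k \<le> C2 * E\<^sup>2" if pos: "\<nu> d > 0"
      proof -
        have \<nu>k: "\<nu> d \<le> \<nu> k" using e k d by (auto simp: ordered_eigenpairs_def)
        have "?x \<le> (K * E)\<^sup>2" using u[OF kn] by (intro power_mono) (auto simp: E_def)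
        then have "2 * a * ?x \<le> 2 * a * (K\<^sup>2 * E\<^sup>2)"
          using a by (intro mult_left_mono) (auto simp: power_mult_distrib)
        moreover have "?s \<le> (max (\<nu> k) 0 - max (\<nu>' k) 0)\<^sup>2 / max (\<nu> k) 0"
          using pos \<nu>k by (intro sqrt_diff_sq_le_square) auto
        moreover have "\<dots> \<le> E\<^sup>2 / \<nu> d"
          using pos \<nu>k ev E by (intro frac_le) (auto simp: abs_le_square_iff[symmetric])
        ultimately show ?thesis using t pos by (simp add: C2_def algebra_simps)
      qed
      show ?thesis using 1 2 by blast
    qed
    have "sum t {1..d} \<le> real d * (C1 * E)"
      using sum_bounded_above[of "{1..d}" t "C1 * E"] bound by simp
    also have "\<dots> \<le> C * E" using C12 E by (simp add: C_def algebra_simps)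
    finally have 1: "sum t {1..d} \<le> C * E" .
    have 2: "sum t {1..d} \<le> C * E\<^sup>2" if "\<nu> d > 0"
    proof -
      have "sum t {1..d} \<le> real d * (C2 * E\<^sup>2)"
        using sum_bounded_above[of "{1..d}" t "C2 * E\<^sup>2"] bound that by simp
      also have "\<dots> \<le> C * E\<^sup>2" using C12 by (simp add: C_def algebra_simps)
      finally show ?thesis .
    qed
    show ?thesis using e 1 2 by (auto simp: Let_def t_def E_def intro!: exI[of _ u])
  qed
  then show thesis using that[OF C] by blast
qed

section \<open>Classical scaling minimizes the strain\<close>

definition coordinate :: "('n::finite \<Rightarrow> nat \<Rightarrow> real) \<Rightarrow> nat \<Rightarrow> real^'n" where
  "coordinate p k = (\<chi> i. p i k)"

definition Gram_matrix :: "nat \<Rightarrow> ('n::finite \<Rightarrow> nat \<Rightarrow> real) \<Rightarrow> real^'n^'n" where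
  "Gram_matrix d p = (\<chi> i j. \<Sum>k=1..d. p i k * p j k)"

text \<open>The Frobenius inner product is the trace of \<open>X\<^sup>T Y\<close>, which can be computed in any orthonormal
  basis. Taking eigenvectors of one of the two matrices makes the strain computable.\<close>
lemma matrix_inner_orthonormal:
  fixes X Y :: "real^'n^'m"
  assumes "orthonormal_upto DIM(real^'n) u"
  shows "X \<bullet> Y = (\<Sum>j=1..CARD('n). (X *v u j) \<bullet> (Y *v u j))"
proof -
  have rows: "x \<bullet> y = (\<Sum>j=1..CARD('n). (x \<bullet> u j) * (y \<bullet> u j))" for x y :: "real^'n"
    using orthonormal_Parseval[OF assms, of x y] by simp
  have "X \<bullet> Y = (\<Sum>i\<in>UNIV. \<Sum>j=1..CARD('n). (X $ i \<bullet> u j) * (Y $ i \<bullet> u j))"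
    unfolding inner_vec_def[of X] by (rule sum.cong[OF refl rows])
  also have "\<dots> = (\<Sum>j=1..CARD('n). \<Sum>i\<in>UNIV. (X $ i \<bullet> u j) * (Y $ i \<bullet> u j))"
    by (rule sum.swap)
  finally show ?thesis
    by (simp add: inner_vec_def[of "X *v _"] matrix_vector_mul_component)
qed

lemma strain_eq_norm: "strain d B p = (norm (Gram_matrix d p - B))\<^sup>2"
  unfolding power2_norm_eq_inner
  by (simp add: strain_def inner_vec_def Gram_matrix_def power2_eq_square)

lemma Gram_matrix_mult: "Gram_matrix d p *v x = (\<Sum>k=1..d. (coordinate p k \<bullet> x) *\<^sub>R coordinate p k)"
proof (simp add: vec_eq_iff, intro allI)
  fix i
  have "(Gram_matrix d p *v x) $ i = (\<Sum>j\<in>UNIV. \<Sum>k=1..d. p i k * p j k * x $ j)"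
    by (simp add: matrix_vector_mult_def Gram_matrix_def sum_distrib_right)
  also have "\<dots> = (\<Sum>k=1..d. \<Sum>j\<in>UNIV. p i k * p j k * x $ j)" by (rule sum.swap)
  also have "\<dots> = (\<Sum>k=1..d. (coordinate p k \<bullet> x) * p i k)"
    by (simp add: coordinate_def inner_vec_def sum_distrib_left mult_ac)
  finally show "(Gram_matrix d p *v x) $ i = (\<Sum>k = Suc 0..d. coordinate p k \<bullet> x * coordinate p k $ i)"
    by (simp add: coordinate_def)
qed

lemma Gram_matrix_symmetric: "transpose (Gram_matrix d p) = Gram_matrix d p"
  by (simp add: Gram_matrix_def transpose_def mult.commute)

lemma config_error_coordinates: "config_error d p p' = (\<Sum>k=1..d. (norm (coordinate p k - coordinate p' k))\<^sup>2)"
proof -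
  have "config_error d p p' = (\<Sum>i\<in>UNIV. \<Sum>k=1..d. (p i k - p' i k)\<^sup>2)"
    by (simp add: config_error_def L2_set_def sum_nonneg)
  also have "\<dots> = (\<Sum>k=1..d. \<Sum>i\<in>UNIV. (p i k - p' i k)\<^sup>2)" by (rule sum.swap)
  finally show ?thesis
    unfolding power2_norm_eq_inner by (simp add: coordinate_def inner_vec_def power2_eq_square)
qed

lemma config_error_nonneg: "config_error d p p' \<ge> 0"
  by (simp add: config_error_def sum_nonneg)

text \<open>With total weight at most \<open>d\<close> and each weight at most 1, a weighted sum of a decreasing sequence
  is largest when the whole weight is on the first \<open>d\<close> entries. The proof compares \<open>f\<close> with the
  threshold \<open>f d\<close>.\<close>
lemma weighted_sum_le_leading_sum:
  fixes f t :: "nat \<Rightarrow> real"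
  assumes d: "d \<in> {1..n}" and f: "\<And>k l. 1 \<le> k \<Longrightarrow> k \<le> l \<Longrightarrow> l \<le> n \<Longrightarrow> f l \<le> f k" "f d \<ge> 0"
    and t: "\<And>l. 0 \<le> t l" "\<And>l. t l \<le> 1" "(\<Sum>l=1..n. t l) \<le> real d"
  shows "(\<Sum>l=1..n. t l * f l) \<le> (\<Sum>l=1..d. f l)"
proof -
  have "(\<Sum>l=1..n. t l * f l) = f d * (\<Sum>l=1..n. t l) + (\<Sum>l=1..n. t l * (f l - f d))"
    by (simp add: sum_distrib_left sum.distrib[symmetric] algebra_simps)
  also have "\<dots> \<le> f d * real d + (\<Sum>l=1..n. if l \<le> d then f l - f d else 0)"
  proof (intro add_mono mult_left_mono sum_mono)
    fix l assume l: "l \<in> {1..n}"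
    show "t l * (f l - f d) \<le> (if l \<le> d then f l - f d else 0)"
    proof (cases "l \<le> d")
      case True
      then show ?thesis using mult_right_mono[OF t(2), of "f l - f d" l] f(1)[of l d] d l by auto
    next
      case False
      then show ?thesis using mult_nonneg_nonpos[OF t(1), of "f l - f d" l] f(1)[of d l] d l by auto
    qed
  qed (use t f in auto)
  also have "(\<Sum>l=1..n. if l \<le> d then f l - f d else 0) = (\<Sum>l=1..d. f l - f d)"
    using d by (intro sum.mono_neutral_cong_right) auto
  finally show ?thesis by (simp add: sum_subtractf mult.commute)
qed

text \<open>Each number \<open>v j \<bullet> B v j\<close> is an average of the eigenvalues with weights
  \<open>(v j \<bullet> u l)\<^sup>2\<close>, so Jensen's inequality for the convex function \<open>x \<mapsto> (max x 0)\<^sup>2\<close> applies. Summed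
  over \<open>j\<close>, the weights are at most 1 for each \<open>l\<close> and at most \<open>d\<close> in total.\<close>
lemma compression_positive_part_le:
  fixes B :: "real^'n^'n"
  assumes e: "ordered_eigenpairs B \<nu> u" and v: "orthonormal_upto DIM(real^'n) v"
    and K: "K \<subseteq> {1..CARD('n)}" "card K \<le> d" and d: "d \<in> {1..CARD('n)}"
  shows "(\<Sum>j\<in>K. (max (v j \<bullet> (B *v v j)) 0)\<^sup>2) \<le> (\<Sum>l=1..d. (max (\<nu> l) 0)\<^sup>2)"
proof -
  let ?n = "CARD('n)"
  have u: "orthonormal_upto DIM(real^'n) u" using e by (simp add: ordered_eigenpairs_iff)
  define s where "s j l = (v j \<bullet> u l)\<^sup>2" for j l
  define x where "x l = max (\<nu> l) 0" for l
  have finK: "finite K" using K(1) finite_subset by blast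
  have s_sum: "(\<Sum>l=1..?n. s j l) = 1" if "j \<in> K" for j
    using orthonormal_Parseval_norm[OF u, of "v j"] orthonormal_upto_norm[OF v, of j] K that
    by (auto simp: s_def)
  have convex: "(max (v j \<bullet> (B *v v j)) 0)\<^sup>2 \<le> (\<Sum>l=1..?n. s j l * (x l)\<^sup>2)" if j: "j \<in> K" for j
  proof -
    define m where "m = (\<Sum>l=1..?n. s j l * x l)"
    have "v j \<bullet> (B *v v j) \<le> m"
      unfolding eigenbasis_quadratic_form[OF e] m_def s_def x_def
      by (intro sum_mono) (simp add: mult.commute[of "(_)\<^sup>2"] mult_right_mono)
    moreover have "m \<ge> 0" unfolding m_def by (intro sum_nonneg) (auto simp: s_def x_def)
    ultimately have "(max (v j \<bullet> (B *v v j)) 0)\<^sup>2 \<le> m\<^sup>2" by (intro power_mono) auto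
    (* Jensen for the square: the variance of x with respect to the weights s j is nonnegative. *)
    moreover have "0 \<le> (\<Sum>l=1..?n. s j l * (x l - m)\<^sup>2)" by (intro sum_nonneg) (auto simp: s_def)
    moreover have "(\<Sum>l=1..?n. s j l * (x l - m)\<^sup>2)
      = (\<Sum>l=1..?n. s j l * (x l)\<^sup>2 - 2 * m * (s j l * x l) + m\<^sup>2 * s j l)"
      by (intro sum.cong refl) (simp add: power2_diff algebra_simps)
    moreover have "\<dots> = (\<Sum>l=1..?n. s j l * (x l)\<^sup>2) - 2 * m * m + m\<^sup>2 * (\<Sum>l=1..?n. s j l)"
      by (simp only: sum.distrib sum_subtractf sum_distrib_left[symmetric] m_def[symmetric])
    ultimately show ?thesis using s_sum[OF j] by (simp add: power2_eq_square)
  qed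
  define t where "t l = (\<Sum>j\<in>K. s j l)" for l
  have t1: "t l \<le> 1" if "l \<in> {1..?n}" for l
  proof -
    have "t l \<le> (\<Sum>j=1..?n. s j l)" unfolding t_def using K by (intro sum_mono2) (auto simp: s_def)
    also have "\<dots> = 1"
      using orthonormal_Parseval_norm[OF v, of "u l"] orthonormal_upto_norm[OF u, of l] that
      by (simp add: s_def inner_commute)
    finally show ?thesis .
  qed
  have "(\<Sum>l=1..?n. t l) = (\<Sum>j\<in>K. \<Sum>l=1..?n. s j l)" unfolding t_def by (rule sum.swap)
  then have t_sum: "(\<Sum>l=1..?n. t l) \<le> real d" using s_sum K(2) by simp
  have "(\<Sum>j\<in>K. (max (v j \<bullet> (B *v v j)) 0)\<^sup>2) \<le> (\<Sum>j\<in>K. \<Sum>l=1..?n. s j l * (x l)\<^sup>2)"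
    by (intro sum_mono convex)
  also have "\<dots> = (\<Sum>l=1..?n. t l * (x l)\<^sup>2)"
    unfolding t_def sum_distrib_right by (rule sum.swap)
  also have "\<dots> = (\<Sum>l=1..?n. (if l \<in> {1..?n} then t l else 0) * (x l)\<^sup>2)"
    by (intro sum.cong) auto
  also have "\<dots> \<le> (\<Sum>l=1..d. (x l)\<^sup>2)"
  proof (rule weighted_sum_le_leading_sum[OF d])
    show "(x l)\<^sup>2 \<le> (x k)\<^sup>2" if "1 \<le> k" "k \<le> l" "l \<le> ?n" for k l
    proof -
      have "\<nu> l \<le> \<nu> k" using e that by (auto simp: ordered_eigenpairs_def)
      then have "x l \<le> x k" unfolding x_def by (rule max.mono) simp
      then show ?thesis by (rule power_mono) (simp add: x_def)
    qed
    show "0 \<le> (if l \<in> {1..?n} then t l else 0)" for l by (auto simp: t_def s_def intro: sum_nonneg)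
    show "(if l \<in> {1..?n} then t l else 0) \<le> 1" for l using t1 by auto
    show "(\<Sum>l=1..?n. if l \<in> {1..?n} then t l else 0) \<le> real d" using t_sum by simp
  qed simp
  finally show ?thesis by (simp add: x_def)
qed

text \<open>The Gram matrix \<open>G\<close> of a configuration in dimension \<open>d\<close> is positive semidefinite with at most
  \<open>d\<close> nonzero eigenvalues \<open>g j\<close>. In an eigenbasis \<open>v\<close> of \<open>G\<close>, and with
  \<open>\<beta> j = v j \<bullet> B v j\<close>, the strain is \<open>|B|\<^sup>2 + (\<Sum>j. (g j)\<^sup>2 - 2 g j \<beta> j)\<close>. As \<open>g j \<ge> 0\<close>, each nonzero
  term of the sum is at least \<open>- (max (\<beta> j) 0)\<^sup>2\<close>.\<close>
lemma strain_lower_bound: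
  fixes B :: "real^'n^'n"
  assumes e: "ordered_eigenpairs B \<nu> u" and d: "d \<in> {1..CARD('n)}"
  shows "(\<Sum>l=1..CARD('n). (\<nu> l)\<^sup>2) - (\<Sum>l=1..d. (max (\<nu> l) 0)\<^sup>2) \<le> strain d B p"
proof -
  let ?n = "CARD('n)" and ?G = "Gram_matrix d p"
  have u: "orthonormal_upto DIM(real^'n) u" using e by (simp add: ordered_eigenpairs_iff)
  obtain g v where ge: "ordered_eigenpairs ?G g v"
    using spectral_theorem_ordered[OF Gram_matrix_symmetric] .
  have v: "orthonormal_upto DIM(real^'n) v" using ge by (simp add: ordered_eigenpairs_iff)
  have Gv: "?G *v v j = g j *\<^sub>R v j" if "j \<in> {1..?n}" for j
    using ge that by (simp add: ordered_eigenpairs_def)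
  define \<beta> where "\<beta> j = v j \<bullet> (B *v v j)" for j
  define K where "K = {j \<in> {1..?n}. g j \<noteq> 0}"
  have K: "K \<subseteq> {1..?n}" by (auto simp: K_def)
  have vv: "v j \<bullet> v j = 1" if "j \<in> {1..?n}" for j
    using orthonormal_upto_norm[OF v, of j] that by (simp add: norm_eq_1)
  (* The range of the Gram matrix is spanned by the d coordinate vectors, so its rank is at most d. *)
  have "v j \<in> span (coordinate p ` {1..d})" if "j \<in> K" for j
  proof -
    have "v j = (1 / g j) *\<^sub>R (?G *v v j)" using that by (simp add: Gv K_def)
    also have "\<dots> \<in> span (coordinate p ` {1..d})"
      unfolding Gram_matrix_mult by (intro span_scale span_sum span_base) auto
    finally show ?thesis .
  qed
  then have "card (v ` K) \<le> card (coordinate p ` {1..d})"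
    using independent_span_bound[of "coordinate p ` {1..d}" "v ` K"] orthonormal_upto_independent[OF v, of K] K
    by auto
  also have "\<dots> \<le> d" using card_image_le[of "{1..d}" "coordinate p"] by simp
  finally have cK: "card K \<le> d"
    using K by (simp add: card_image inj_on_subset[OF orthonormal_upto_inj[OF v]])
  have g0: "g j \<ge> 0" if j: "j \<in> {1..?n}" for j
  proof -
    have "g j = v j \<bullet> (?G *v v j)" using Gv[OF j] vv[OF j] by simp
    also have "\<dots> = (\<Sum>k=1..d. (coordinate p k \<bullet> v j)\<^sup>2)"
      by (simp add: Gram_matrix_mult inner_sum_right power2_eq_square inner_commute)
    finally show ?thesis by (simp add: sum_nonneg)
  qed
  have "?G \<bullet> ?G = (\<Sum>j=1..?n. (g j)\<^sup>2)" "?G \<bullet> B = (\<Sum>j=1..?n. g j * \<beta> j)"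
    unfolding matrix_inner_orthonormal[OF v]
    by (auto intro!: sum.cong simp: Gv vv \<beta>_def power2_eq_square)
  moreover have "B \<bullet> B = (\<Sum>l=1..?n. (\<nu> l)\<^sup>2)"
    unfolding matrix_inner_orthonormal[OF u]
    using e by (auto intro!: sum.cong simp: ordered_eigenpairs_def power2_eq_square)
  moreover have "strain d B p = ?G \<bullet> ?G - 2 * (?G \<bullet> B) + B \<bullet> B"
    by (simp add: strain_eq_norm power2_norm_eq_inner inner_diff_left inner_diff_right inner_commute)
  moreover have "(\<Sum>j=1..?n. (g j)\<^sup>2) - 2 * (\<Sum>j=1..?n. g j * \<beta> j) = (\<Sum>j=1..?n. (g j)\<^sup>2 - 2 * (g j * \<beta> j))"
    by (simp add: sum_subtractf sum_distrib_left)
  moreover have "\<dots> = (\<Sum>j\<in>K. (g j)\<^sup>2 - 2 * (g j * \<beta> j))"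
    by (rule sum.mono_neutral_right) (auto simp: K_def)
  moreover have "\<dots> \<ge> (\<Sum>j\<in>K. - (max (\<beta> j) 0)\<^sup>2)"
  proof (intro sum_mono)
    fix j assume "j \<in> K"
    then have "g j * \<beta> j \<le> g j * max (\<beta> j) 0" using g0 K by (intro mult_left_mono) auto
    moreover have "0 \<le> (g j - max (\<beta> j) 0)\<^sup>2" by simp
    ultimately show "- (max (\<beta> j) 0)\<^sup>2 \<le> (g j)\<^sup>2 - 2 * (g j * \<beta> j)"
      unfolding power2_diff by linarith
  qed
  moreover have "(\<Sum>j\<in>K. (max (\<beta> j) 0)\<^sup>2) \<le> (\<Sum>l=1..d. (max (\<nu> l) 0)\<^sup>2)"
    unfolding \<beta>_def by (rule compression_positive_part_le[OF e v K cK d])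
  ultimately show ?thesis unfolding sum_negf by linarith
qed

lemma strain_of_eigenvector_configuration:
  fixes B :: "real^'n^'n"
  assumes e: "ordered_eigenpairs B \<nu> u" and d: "d \<in> {1..CARD('n)}"
    and p: "\<And>k. k \<in> {1..d} \<Longrightarrow> coordinate p k = sqrt (max (\<nu> k) 0) *\<^sub>R u k"
  shows "strain d B p = (\<Sum>l=1..CARD('n). (\<nu> l)\<^sup>2) - (\<Sum>l=1..d. (max (\<nu> l) 0)\<^sup>2)"
proof -
  let ?n = "CARD('n)" and ?G = "Gram_matrix d p"
  have u: "orthonormal_upto DIM(real^'n) u" using e by (simp add: ordered_eigenpairs_iff)
  define c where "c j = (if j \<le> d then max (\<nu> j) 0 else 0)" for j
  have Gu: "?G *v u j = c j *\<^sub>R u j" if j: "j \<in> {1..?n}" for j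
  proof -
    have "?G *v u j = (\<Sum>k=1..d. if k = j then max (\<nu> j) 0 *\<^sub>R u j else 0)"
      unfolding Gram_matrix_mult
    proof (intro sum.cong refl)
      fix k assume k: "k \<in> {1..d}"
      then have "u k \<bullet> u j = (if k = j then 1 else 0)"
        using orthonormal_upto_inner[OF u, of k j] j d by auto
      then show "(coordinate p k \<bullet> u j) *\<^sub>R coordinate p k = (if k = j then max (\<nu> j) 0 *\<^sub>R u j else 0)"
        by (simp add: p[OF k])
    qed
    then show ?thesis using j by (auto simp: c_def sum.delta)
  qed
  have residual: "((?G - B) *v u j) \<bullet> ((?G - B) *v u j) = (\<nu> j)\<^sup>2 - (c j)\<^sup>2" if j: "j \<in> {1..?n}" for j
  proof -
    have eq: "(?G - B) *v u j = (c j - \<nu> j) *\<^sub>R u j"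
      using Gu[OF j] e j by (simp add: ordered_eigenpairs_def matrix_vector_mult_diff_rdistrib algebra_simps)
    have "u j \<bullet> u j = 1" using orthonormal_upto_norm[OF u, of j] j by (simp add: norm_eq_1)
    then show ?thesis unfolding eq by (auto simp: c_def max_def power2_eq_square algebra_simps)
  qed
  have "strain d B p = (\<Sum>j=1..?n. (\<nu> j)\<^sup>2 - (c j)\<^sup>2)"
    unfolding strain_eq_norm power2_norm_eq_inner matrix_inner_orthonormal[OF u]
    by (intro sum.cong refl residual)
  also have "\<dots> = (\<Sum>j=1..?n. (\<nu> j)\<^sup>2) - (\<Sum>j=1..?n. (c j)\<^sup>2)" by (rule sum_subtractf)
  also have "(\<Sum>j=1..?n. (c j)\<^sup>2) = (\<Sum>j=1..d. (max (\<nu> j) 0)\<^sup>2)"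
    using d by (intro sum.mono_neutral_cong_right) (auto simp: c_def)
  finally show ?thesis .
qed

lemma classical_scaling_coordinate:
  assumes "k \<in> {1..d}"
  shows "coordinate (\<lambda>i. \<lambda>k\<in>{1..d}. sqrt (max (\<nu> k) 0) * u k $ i) k = sqrt (max (\<nu> k) 0) *\<^sub>R u k"
  using assms by (simp add: coordinate_def vec_eq_iff)

theorem classical_scaling_minimizes_strain:
  fixes D :: "real^'n^'n"
  assumes p: "p \<in> classical_scaling d D" and d: "d \<in> {1..CARD('n)}"
  shows "p \<in> strain_minimizers d (B_matrix D)"
proof -
  obtain \<nu> u where e: "ordered_eigenpairs (B_matrix D) \<nu> u"
    and p: "p = (\<lambda>i. \<lambda>k\<in>{1..d}. sqrt (max (\<nu> k) 0) * u k $ i)"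
    using p unfolding classical_scaling_def by blast
  have "coordinate p k = sqrt (max (\<nu> k) 0) *\<^sub>R u k" if "k \<in> {1..d}" for k
    unfolding p by (rule classical_scaling_coordinate[OF that])
  then have "strain d (B_matrix D) p \<le> strain d (B_matrix D) p'" for p'
    using strain_of_eigenvector_configuration[OF e d] strain_lower_bound[OF e d] by metis
  moreover have "p \<in> configurations d" by (simp add: configurations_def p)
  ultimately show ?thesis by (simp add: strain_minimizers_def is_arg_min_def not_less)
qed

section \<open>A closest strain minimizer\<close>

lemma compact_PiE_UNIV:
  fixes S :: "'i \<Rightarrow> 'b::topological_space set"
  assumes "\<And>i. compact (S i)"
  shows "compact (PiE UNIV S)"
  using compactin_PiE[of "\<lambda>_. euclidean" UNIV S] assms by (simp add: euclidean_product_topology)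

text \<open>Configurations are functions that are fixed outside \<open>{1..d}\<close>, so a bounded set of them is a
  product of compact sets, with singletons as the factors outside \<open>{1..d}\<close>.\<close>
lemma compact_bounded_configurations:
  "compact {p \<in> (configurations d :: ('n \<Rightarrow> nat \<Rightarrow> real) set). \<forall>i. \<forall>k\<in>{1..d}. \<bar>p i k\<bar> \<le> (R::real)}"
proof -
  define S where "S k = (if k \<in> {1..d} then {-R..R} else {undefined})" for k
  have S: "compact (S k)" for k by (cases "k \<in> {1..d}") (auto simp: S_def)
  have "compact (PiE UNIV (\<lambda>_::'n. PiE UNIV S))"
    by (rule compact_PiE_UNIV, rule compact_PiE_UNIV, rule S)
  moreover have "PiE UNIV (\<lambda>_::'n. PiE UNIV S) = {p \<in> configurations d. \<forall>i. \<forall>k\<in>{1..d}. \<bar>p i k\<bar> \<le> R}"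
  proof -
    have "f \<in> PiE UNIV S \<longleftrightarrow> f \<in> {1..d} \<rightarrow>\<^sub>E UNIV \<and> (\<forall>k\<in>{1..d}. \<bar>f k\<bar> \<le> R)" for f
    proof -
      have "f \<in> PiE UNIV S \<longleftrightarrow> (\<forall>k. f k \<in> S k)" by (simp add: PiE_iff)
      also have "\<dots> \<longleftrightarrow> (\<forall>k. (k \<in> {1..d} \<longrightarrow> \<bar>f k\<bar> \<le> R) \<and> (k \<notin> {1..d} \<longrightarrow> f k = undefined))"
        by (intro all_cong1) (simp add: S_def abs_le_iff neg_le_iff_le minus_le_iff, linarith)
      also have "\<dots> \<longleftrightarrow> f \<in> {1..d} \<rightarrow>\<^sub>E UNIV \<and> (\<forall>k\<in>{1..d}. \<bar>f k\<bar> \<le> R)"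
        unfolding PiE_iff extensional_def Ball_def mem_Collect_eq
        by (simp add: all_conj_distrib conj_commute del: atLeastAtMost_iff)
      finally show ?thesis .
    qed
    moreover have "p \<in> PiE UNIV (\<lambda>_. PiE UNIV S) \<longleftrightarrow> (\<forall>i. p i \<in> PiE UNIV S)" for p :: "'n \<Rightarrow> nat \<Rightarrow> real"
      by (simp only: PiE_iff[of p] extensional_UNIV UNIV_I ball_UNIV simp_thms)
    ultimately show ?thesis
      by (simp only: set_eq_iff configurations_def mem_Collect_eq all_conj_distrib simp_thms)
  qed
  ultimately show ?thesis by simp
qed

lemma continuous_on_config_coordinate [continuous_intros]:
  "continuous_on S (\<lambda>p :: 'n \<Rightarrow> nat \<Rightarrow> real. p i k)"
  by (rule continuous_on_product_then_coordinatewise, rule continuous_on_product_then_coordinatewise,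
      rule continuous_on_id)

text \<open>Only the minimizers at least as close to \<open>p'\<close> as the given one \<open>p\<^sub>0\<close> matter. They form a closed
  and bounded set of configurations.\<close>
lemma closest_strain_minimizer_exists:
  fixes B :: "real^'n^'n"
  assumes p0: "p\<^sub>0 \<in> strain_minimizers d B"
  shows "\<exists>p. is_arg_min (\<lambda>p. config_error d p p') (\<lambda>p. p \<in> strain_minimizers d B) p"
proof -
  define e where "e = config_error d p\<^sub>0 p'"
  (* Each coordinate is within sqrt e of the same coordinate of p'. *)
  define R where "R = sqrt e + (\<Sum>i\<in>UNIV. \<Sum>k=1..d. \<bar>p' i k\<bar>)"
  have minimizers: "strain_minimizers d B = {p \<in> configurations d. strain d B p \<le> strain d B p\<^sub>0}"
    using p0 by (auto simp: strain_minimizers_def is_arg_min_def not_less)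
  define S where "S = {p \<in> configurations d. \<forall>i. \<forall>k\<in>{1..d}. \<bar>p i k\<bar> \<le> R} \<inter>
    {p. strain d B p \<le> strain d B p\<^sub>0} \<inter> {p. config_error d p p' \<le> e}"
  have cont: "continuous_on T (\<lambda>p. config_error d p p')" "continuous_on T (strain d B)" for T
    unfolding config_error_def strain_def L2_set_def by (intro continuous_intros)+
  have comp: "compact S"
    unfolding S_def
    by (intro compact_Int_closed compact_bounded_configurations closed_Collect_le cont continuous_on_const)
  have in_S: "p \<in> S" if p: "p \<in> strain_minimizers d B" "config_error d p p' \<le> e" for p
  proof -
    have "\<bar>p i k\<bar> \<le> R" if k: "k \<in> {1..d}" for i k
    proof -
      have "(p i k - p' i k)\<^sup>2 = (coordinate p k - coordinate p' k) $ i * (coordinate p k - coordinate p' k) $ i"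
        by (simp add: coordinate_def power2_eq_square)
      also have "\<dots> \<le> (norm (coordinate p k - coordinate p' k))\<^sup>2"
        using component_le_norm_cart[of "coordinate p k - coordinate p' k" i]
        by (simp add: abs_le_square_iff[symmetric] flip: power2_eq_square)
      also have "\<dots> \<le> config_error d p p'"
        unfolding config_error_coordinates using k by (intro member_le_sum) auto
      finally have "\<bar>p i k - p' i k\<bar> \<le> sqrt e"
        using p(2) real_le_rsqrt[of "\<bar>p i k - p' i k\<bar>" e] by simp
      moreover have "\<bar>p' i k\<bar> \<le> (\<Sum>i\<in>UNIV. \<Sum>k=1..d. \<bar>p' i k\<bar>)"
        using member_le_sum[of k "{1..d}" "\<lambda>k. \<bar>p' i k\<bar>"] k
          member_le_sum[of i UNIV "\<lambda>i. \<Sum>k=1..d. \<bar>p' i k\<bar>"] by (fastforce intro: sum_nonneg)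
      ultimately show ?thesis unfolding R_def by linarith
    qed
    then show ?thesis using p by (auto simp: S_def minimizers)
  qed
  have ne: "S \<noteq> {}" using in_S[OF p0] by (auto simp: e_def)
  obtain p where p: "p \<in> S" "\<And>y. y \<in> S \<Longrightarrow> config_error d p p' \<le> config_error d y p'"
    using continuous_attains_inf[OF comp ne cont(1)] by auto
  have "p \<in> strain_minimizers d B" using p(1) by (auto simp: S_def minimizers)
  moreover have "config_error d p p' \<le> config_error d y p'" if y: "y \<in> strain_minimizers d B" for y
  proof (cases "config_error d y p' \<le> e")
    case True
    then show ?thesis using p(2) in_S[OF y] by blast
  next
    case False
    then show ?thesis using p(1) by (simp add: S_def)
  qed
  ultimately show ?thesis by (auto simp: is_arg_min_def not_less)
qed

section \<open>Classical scaling under perturbation of the dissimilarities\<close>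

lemma B_matrix_symmetric:
  assumes "nonneg_symmetric D"
  shows "transpose (B_matrix D) = B_matrix D"
proof -
  have "D $ i $ j = D $ j $ i" for i j using assms by (simp add: nonneg_symmetric_def)
  then have A: "A_matrix D $ i $ j = A_matrix D $ j $ i" for i j by (simp add: A_matrix_def)
  have "(\<Sum>l\<in>UNIV. A_matrix D $ i $ l) = (\<Sum>l\<in>UNIV. A_matrix D $ l $ i)" for i
    by (rule sum.cong[OF refl A])
  then show ?thesis by (simp add: B_matrix_def double_center_def transpose_def vec_eq_iff A)
qed

lemma isCont_A_matrix: "isCont (A_matrix :: real^'n^'n \<Rightarrow> real^'n^'n) D"
proof -
  have "continuous_on UNIV (A_matrix :: real^'n^'n \<Rightarrow> real^'n^'n)"
    unfolding A_matrix_def by (intro continuous_intros)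
  then show ?thesis by (simp add: continuous_on_eq_continuous_at)
qed

lemma linear_double_center: "linear (double_center :: real^'n^'n \<Rightarrow> real^'n^'n)"
  by (rule linearI)
    (simp_all add: double_center_def vec_eq_iff sum.distrib sum_distrib_left[symmetric] add_divide_distrib
      algebra_simps)

theorem classical_scaling_perturbation:
  fixes D :: "real^'n^'n"
  assumes D: "nonneg_symmetric D" and e0: "ordered_eigenpairs (B_matrix D) \<nu> u\<^sub>0"
    and d: "d \<in> {1..CARD('n)}"
  obtains C where "C > 0"
    "\<And>D' p'. p' \<in> classical_scaling d D' \<Longrightarrow>
      \<exists>p\<in>classical_scaling d D. config_error d p p' \<le> C * norm (A_matrix D - A_matrix D') \<and>
        (\<nu> d > 0 \<longrightarrow> config_error d p p' \<le> C * (norm (A_matrix D - A_matrix D'))\<^sup>2)"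
proof -
  obtain C1 where C1: "C1 > 0" and pert: "\<And>B' \<nu>' u'. ordered_eigenpairs B' \<nu>' u' \<Longrightarrow>
      \<exists>u. ordered_eigenpairs (B_matrix D) \<nu> u \<and>
        (let err = \<Sum>k=1..d. (norm (sqrt (max (\<nu> k) 0) *\<^sub>R u k - sqrt (max (\<nu>' k) 0) *\<^sub>R u' k))\<^sup>2
         in err \<le> C1 * norm (B_matrix D - B') \<and> (\<nu> d > 0 \<longrightarrow> err \<le> C1 * (norm (B_matrix D - B'))\<^sup>2))"
    using scaled_eigenvectors_perturbation[OF B_matrix_symmetric[OF D] e0 d] by blast
  obtain L where L: "L > 0" "\<And>x :: real^'n^'n. norm (double_center x) \<le> L * norm x"
    using linear_bounded_pos[OF linear_double_center] by blast
  define C where "C = C1 * L + C1 * L\<^sup>2"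
  have C: "C > 0" "C1 * L \<le> C" "C1 * L\<^sup>2 \<le> C" using C1 L by (auto simp: C_def intro: add_pos_pos)
  have "\<exists>p\<in>classical_scaling d D. config_error d p p' \<le> C * norm (A_matrix D - A_matrix D') \<and>
        (\<nu> d > 0 \<longrightarrow> config_error d p p' \<le> C * (norm (A_matrix D - A_matrix D'))\<^sup>2)"
    if p': "p' \<in> classical_scaling d D'" for D' p'
  proof -
    obtain \<nu>' u' where e': "ordered_eigenpairs (B_matrix D') \<nu>' u'"
      and p': "p' = (\<lambda>i. \<lambda>k\<in>{1..d}. sqrt (max (\<nu>' k) 0) * u' k $ i)"
      using p' unfolding classical_scaling_def by blast
    obtain u where e: "ordered_eigenpairs (B_matrix D) \<nu> u"
      and err: "let err = \<Sum>k=1..d. (norm (sqrt (max (\<nu> k) 0) *\<^sub>R u k - sqrt (max (\<nu>' k) 0) *\<^sub>R u' k))\<^sup>2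
         in err \<le> C1 * norm (B_matrix D - B_matrix D') \<and>
           (\<nu> d > 0 \<longrightarrow> err \<le> C1 * (norm (B_matrix D - B_matrix D'))\<^sup>2)"
      using pert[OF e'] by blast
    define p where "p = (\<lambda>i. \<lambda>k\<in>{1..d}. sqrt (max (\<nu> k) 0) * u k $ i)"
    have "p \<in> classical_scaling d D" unfolding p_def classical_scaling_def using e by blast
    define a where "a = norm (A_matrix D - A_matrix D')"
    define b where "b = norm (B_matrix D - B_matrix D')"
    have "config_error d p p' =
        (\<Sum>k=1..d. (norm (sqrt (max (\<nu> k) 0) *\<^sub>R u k - sqrt (max (\<nu>' k) 0) *\<^sub>R u' k))\<^sup>2)"
      unfolding config_error_coordinates p_def p'
      by (intro sum.cong refl) (simp only: classical_scaling_coordinate)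
    then have err: "config_error d p p' \<le> C1 * b" "\<nu> d > 0 \<longrightarrow> config_error d p p' \<le> C1 * b\<^sup>2"
      using err by (simp_all add: Let_def b_def)
    have "b \<le> L * a"
      using L(2)[of "A_matrix D - A_matrix D'"]
      by (simp add: a_def b_def B_matrix_def linear_diff[OF linear_double_center])
    have a: "a \<ge> 0" "b \<ge> 0" by (auto simp: a_def b_def)
    have "C1 * b \<le> C1 * (L * a)" using \<open>b \<le> L * a\<close> C1 by simp
    also have "\<dots> \<le> C * a" using mult_right_mono[OF C(2) a(1)] by (simp add: mult.assoc)
    finally have 1: "C1 * b \<le> C * a" .
    have "b\<^sup>2 \<le> (L * a)\<^sup>2" using \<open>b \<le> L * a\<close> a by (intro power_mono)
    then have "C1 * b\<^sup>2 \<le> C1 * (L * a)\<^sup>2" using C1 by simp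
    also have "\<dots> \<le> C * a\<^sup>2" using mult_right_mono[OF C(3), of "a\<^sup>2"] by (simp add: power_mult_distrib mult.assoc)
    finally have 2: "C1 * b\<^sup>2 \<le> C * a\<^sup>2" .
    show ?thesis
      using \<open>p \<in> classical_scaling d D\<close> err 1 2 unfolding a_def by (intro bexI[of _ p]) auto
  qed
  then show thesis using that[OF C(1)] by blast
qed

section \<open>Consistency and rate of convergence\<close>

lemma eigenvalues_unique:
  fixes B :: "real^'n^'n"
  assumes "ordered_eigenpairs B \<nu> u" "ordered_eigenpairs B \<nu>' u'" "k \<in> {1..CARD('n)}"
  shows "\<nu> k = \<nu>' k"
  using Weyl_inequality[OF assms] Weyl_inequality[OF assms(2,1,3)] by simp

text \<open>If \<open>|Y|\<close> exceeds \<open>\<epsilon>\<close>, then by continuity of \<open>f\<close> some entry of \<open>Dhat\<close> is off by more than some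
  \<open>\<eta>\<close>. There are finitely many entries, and the events that they are off are measurable, so the outer
  measure is bounded by a finite sum of probabilities tending to 0.\<close>
lemma tendsto_in_prob_vanishing:
  fixes M :: "'w measure" and Y :: "'i \<Rightarrow> 'w \<Rightarrow> real" and Dhat :: "'i \<Rightarrow> 'w \<Rightarrow> real^'n^'n"
  assumes meas: "\<And>m i j. (\<lambda>\<omega>. Dhat m \<omega> $ i $ j) \<in> borel_measurable M"
    and conv: "\<And>i j. tendsto_in_prob M (\<lambda>m \<omega>. Dhat m \<omega> $ i $ j) (D $ i $ j) F"
    and f: "isCont f D" "f D = 0"
    and Y: "\<And>m \<omega>. \<omega> \<in> space M \<Longrightarrow> \<bar>Y m \<omega>\<bar> \<le> f (Dhat m \<omega>)"
  shows "tendsto_in_prob M Y 0 F"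
  unfolding tendsto_in_prob_def
proof (intro allI impI)
  fix \<epsilon> :: real assume "\<epsilon> > 0"
  then obtain r where r: "r > 0" "\<And>D'. dist D' D < r \<Longrightarrow> dist (f D') (f D) < \<epsilon>"
    using f(1) unfolding continuous_at_eps_delta by (auto simp: dist_norm)
  (* If all entries are off by at most \<eta>, the norm is off by at most n\<^sup>2 \<eta> = r / 2. *)
  define \<eta> where "\<eta> = r / (2 * (real CARD('n))\<^sup>2)"
  have \<eta>: "\<eta> > 0" using r by (simp add: \<eta>_def)
  define bad where "bad m ij = {\<omega> \<in> space M. \<eta> < \<bar>Dhat m \<omega> $ fst ij $ snd ij - D $ fst ij $ snd ij\<bar>}"
    for m and ij :: "'n \<times> 'n"
  have bad: "bad m ij \<in> sets M" for m ij
    unfolding bad_def using meas[of m "fst ij" "snd ij"] by measurable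
  have sub: "{\<omega> \<in> space M. \<epsilon> < \<bar>Y m \<omega> - 0\<bar>} \<subseteq> (\<Union>ij\<in>UNIV. bad m ij)" for m
  proof
    fix \<omega> assume \<omega>: "\<omega> \<in> {\<omega> \<in> space M. \<epsilon> < \<bar>Y m \<omega> - 0\<bar>}"
    show "\<omega> \<in> (\<Union>ij\<in>UNIV. bad m ij)"
    proof (rule ccontr)
      assume "\<omega> \<notin> (\<Union>ij\<in>UNIV. bad m ij)"
      then have small: "\<bar>(Dhat m \<omega> - D) $ i $ j\<bar> \<le> \<eta>" for i j
        using \<omega> by (auto simp: bad_def not_less dest: spec[of _ "(i, j)"])
      have "norm (Dhat m \<omega> - D) \<le> (\<Sum>i\<in>UNIV. norm ((Dhat m \<omega> - D) $ i))"
        unfolding norm_vec_def[of "Dhat m \<omega> - D"] by (rule L2_set_le_sum) simp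
      also have "\<dots> \<le> (\<Sum>i\<in>UNIV. \<Sum>j\<in>UNIV. \<bar>(Dhat m \<omega> - D) $ i $ j\<bar>)"
        by (intro sum_mono norm_le_l1_cart)
      also have "\<dots> \<le> (\<Sum>i\<in>(UNIV::'n set). \<Sum>j\<in>(UNIV::'n set). \<eta>)"
        by (intro sum_mono small)
      also have "\<dots> < r" using r by (simp add: \<eta>_def power2_eq_square)
      finally have "\<bar>f (Dhat m \<omega>)\<bar> < \<epsilon>"
        using r(2)[of "Dhat m \<omega>"] f(2) by (simp add: dist_norm)
      then show False using \<omega> Y[of \<omega> m] by auto
    qed
  qed
  have le: "outer_measure_of M {\<omega> \<in> space M. \<epsilon> < \<bar>Y m \<omega> - 0\<bar>}
      \<le> (\<Sum>ij\<in>UNIV. outer_measure_of M (bad m ij))" for m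
  proof -
    have "outer_measure_of M {\<omega> \<in> space M. \<epsilon> < \<bar>Y m \<omega> - 0\<bar>} \<le> outer_measure_of M (\<Union>ij\<in>UNIV. bad m ij)"
      by (rule outer_measure_of_mono[OF sub])
    also have "\<dots> = emeasure M (\<Union>ij\<in>UNIV. bad m ij)"
      using bad by (intro outer_measure_of_eq sets.finite_UN) auto
    also have "\<dots> \<le> (\<Sum>ij\<in>UNIV. emeasure M (bad m ij))"
      using bad by (intro emeasure_subadditive_finite) auto
    finally show ?thesis using bad by simp
  qed
  have "((\<lambda>m. outer_measure_of M (bad m ij)) \<longlongrightarrow> 0) F" for ij
    using conv[of "fst ij" "snd ij"] \<eta> unfolding tendsto_in_prob_def bad_def by blast
  then have "((\<lambda>m. \<Sum>ij\<in>UNIV. outer_measure_of M (bad m ij)) \<longlongrightarrow> (\<Sum>ij\<in>(UNIV :: ('n \<times> 'n) set). 0)) F"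
    by (intro tendsto_sum)
  then have lim: "((\<lambda>m. \<Sum>ij\<in>UNIV. outer_measure_of M (bad m ij)) \<longlongrightarrow> 0) F" by simp
  show "((\<lambda>m. outer_measure_of M {\<omega> \<in> space M. \<epsilon> < \<bar>Y m \<omega> - 0\<bar>}) \<longlongrightarrow> 0) F"
    by (rule tendsto_sandwich[OF _ _ tendsto_const lim]) (use le in simp_all)
qed

theorem proposition2p7:
  fixes L :: "(real^'d) measure"
    and q :: "'n::finite \<Rightarrow> real^'d \<Rightarrow> real"
    and \<delta> :: "(real^'d \<Rightarrow> real) \<Rightarrow> (real^'d \<Rightarrow> real) \<Rightarrow> real"
    and D :: "real^'n^'n"
    and de :: nat
    and M :: "'w measure"
    and X :: "('n \<Rightarrow> nat) \<Rightarrow> 'n \<Rightarrow> nat \<Rightarrow> 'w \<Rightarrow> real^'d"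
    and est :: "('n \<Rightarrow> nat) \<Rightarrow> ('n \<Rightarrow> (real^'d) list) \<Rightarrow> real^'n^'n"
    and Dhat :: "('n \<Rightarrow> nat) \<Rightarrow> 'w \<Rightarrow> real^'n^'n"
  assumes "sets L = sets borel"
    and "\<And>j. is_density L (q j)"
    and "dissimilarity L \<delta>"
    and "D = (\<chi> i j. \<delta> (q i) (q j))"
    and "1 \<le> de" "de \<le> CARD('n)"
    and "prob_space M"
    and "\<And>m j. iid_sample M L (q j) (m j) (X m j)"
    and "\<And>m s. (\<forall>j. length (s j) = m j) \<Longrightarrow> nonneg_symmetric (est m s)"
    and "\<And>m \<omega>. Dhat m \<omega> = est m (\<lambda>j. map (\<lambda>l. X m j l \<omega>) [0..<m j])"
    and "\<And>m i j. (\<lambda>\<omega>. Dhat m \<omega> $ i $ j) \<in> borel_measurable M"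
    and "\<And>i j. tendsto_in_prob M (\<lambda>m \<omega>. Dhat m \<omega> $ i $ j) (D $ i $ j) sizes_to_infinity"
  shows
    "(\<forall>phat. (\<forall>m. \<forall>\<omega>\<in>space M. phat m \<omega> \<in> classical_scaling de (Dhat m \<omega>)) \<longrightarrow>
        tendsto_in_prob M (\<lambda>m \<omega>. INF p\<in>classical_scaling de D. config_error de p (phat m \<omega>))
          0 sizes_to_infinity) \<and>
     (\<exists>C>0. \<forall>\<nu> u. ordered_eigenpairs (B_matrix D) \<nu> u \<longrightarrow>
        (\<forall>D' p'. nonneg_symmetric D' \<longrightarrow> p' \<in> classical_scaling de D' \<longrightarrow>
          (\<exists>p. is_arg_min (\<lambda>p. config_error de p p') (\<lambda>p. p \<in> strain_minimizers de (B_matrix D)) p \<and>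
             (\<nu> de > 0 \<longrightarrow> config_error de p p'
                \<le> C * (real CARD('n))\<^sup>2 * (norm (A_matrix D - A_matrix D'))\<^sup>2) \<and>
             (\<nu> de = 0 \<longrightarrow> config_error de p p'
                \<le> C * (real CARD('n))\<^sup>2 * norm (A_matrix D - A_matrix D')))))"
proof -
  have D: "nonneg_symmetric D"
    using assms(2-4) by (simp add: nonneg_symmetric_def dissimilarity_def)
  have de: "de \<in> {1..CARD('n)}" using assms(5,6) by simp
  obtain \<nu>\<^sub>0 u\<^sub>0 where e0: "ordered_eigenpairs (B_matrix D) \<nu>\<^sub>0 u\<^sub>0"
    using spectral_theorem_ordered[OF B_matrix_symmetric[OF D]] .
  obtain C where C: "C > 0" and pert: "\<And>D' p'. p' \<in> classical_scaling de D' \<Longrightarrow>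
      \<exists>p\<in>classical_scaling de D. config_error de p p' \<le> C * norm (A_matrix D - A_matrix D') \<and>
        (\<nu>\<^sub>0 de > 0 \<longrightarrow> config_error de p p' \<le> C * (norm (A_matrix D - A_matrix D'))\<^sup>2)"
    using classical_scaling_perturbation[OF D e0 de] by blast
  show ?thesis
  proof (intro conjI allI impI)
    fix phat assume phat: "\<forall>m. \<forall>\<omega>\<in>space M. phat m \<omega> \<in> classical_scaling de (Dhat m \<omega>)"
    show "tendsto_in_prob M (\<lambda>m \<omega>. INF p\<in>classical_scaling de D. config_error de p (phat m \<omega>))
        0 sizes_to_infinity"
    proof (rule tendsto_in_prob_vanishing[OF assms(11,12)])
      show "isCont (\<lambda>D'. C * norm (A_matrix D - A_matrix D')) D"
        by (intro continuous_intros isCont_A_matrix)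
      fix m \<omega> assume "\<omega> \<in> space M"
      then obtain p where p: "p \<in> classical_scaling de D"
        "config_error de p (phat m \<omega>) \<le> C * norm (A_matrix D - A_matrix (Dhat m \<omega>))"
        using phat pert by meson
      have "(INF p\<in>classical_scaling de D. config_error de p (phat m \<omega>)) \<le> config_error de p (phat m \<omega>)"
        by (rule cINF_lower[OF bdd_belowI2 p(1)]) (rule config_error_nonneg)
      moreover have "(INF p\<in>classical_scaling de D. config_error de p (phat m \<omega>)) \<ge> 0"
        using p(1) by (intro cINF_greatest config_error_nonneg) auto
      ultimately show "\<bar>INF p\<in>classical_scaling de D. config_error de p (phat m \<omega>)\<bar>
          \<le> C * norm (A_matrix D - A_matrix (Dhat m \<omega>))"
        using p(2) by simp
    qed simp
  next
    let ?N = "(real CARD('n))\<^sup>2"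
    have N: "C * x \<le> C * ?N * x" if "x \<ge> 0" for x
    proof -
      have "1 \<le> ?N" by (simp add: Suc_leI)
      then have "C * 1 \<le> C * ?N" using C by (intro mult_left_mono) auto
      then show ?thesis using that mult_right_mono[of "C * 1" "C * ?N" x] by simp
    qed
    have "\<exists>p. is_arg_min (\<lambda>p. config_error de p p') (\<lambda>p. p \<in> strain_minimizers de (B_matrix D)) p \<and>
             (\<nu> de > 0 \<longrightarrow> config_error de p p' \<le> C * ?N * (norm (A_matrix D - A_matrix D'))\<^sup>2) \<and>
             (\<nu> de = 0 \<longrightarrow> config_error de p p' \<le> C * ?N * norm (A_matrix D - A_matrix D'))"
      if e: "ordered_eigenpairs (B_matrix D) \<nu> u" and p': "p' \<in> classical_scaling de D'" for \<nu> u D' p'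
    proof -
      have \<nu>: "\<nu> de = \<nu>\<^sub>0 de" by (rule eigenvalues_unique[OF e e0 de])
      obtain q where q: "q \<in> classical_scaling de D"
        "config_error de q p' \<le> C * norm (A_matrix D - A_matrix D')"
        "\<nu> de > 0 \<Longrightarrow> config_error de q p' \<le> C * (norm (A_matrix D - A_matrix D'))\<^sup>2"
        using pert[OF p'] \<nu> by auto
      have qmin: "q \<in> strain_minimizers de (B_matrix D)"
        by (rule classical_scaling_minimizes_strain[OF q(1) de])
      obtain p where p: "is_arg_min (\<lambda>p. config_error de p p') (\<lambda>p. p \<in> strain_minimizers de (B_matrix D)) p"
        using closest_strain_minimizer_exists[OF qmin] by blast
      have "config_error de p p' \<le> config_error de q p'"
        using p qmin by (auto simp: is_arg_min_def not_less)
      then show ?thesis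
        using p q(2,3) N[of "norm (A_matrix D - A_matrix D')"] N[of "(norm (A_matrix D - A_matrix D'))\<^sup>2"]
        by (intro exI[of _ p]) (auto intro: order_trans)
    qed
    then show "\<exists>C>0. \<forall>\<nu> u. ordered_eigenpairs (B_matrix D) \<nu> u \<longrightarrow>
        (\<forall>D' p'. nonneg_symmetric D' \<longrightarrow> p' \<in> classical_scaling de D' \<longrightarrow>
          (\<exists>p. is_arg_min (\<lambda>p. config_error de p p') (\<lambda>p. p \<in> strain_minimizers de (B_matrix D)) p \<and>
             (\<nu> de > 0 \<longrightarrow> config_error de p p'
                \<le> C * (real CARD('n))\<^sup>2 * (norm (A_matrix D - A_matrix D'))\<^sup>2) \<and>
             (\<nu> de = 0 \<longrightarrow> config_error de p p'
                \<le> C * (real CARD('n))\<^sup>2 * norm (A_matrix D - A_matrix D'))))"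
      using C by (intro exI[of _ C] conjI allI impI) auto
  qed
qed

end
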